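(* Let $\Omega_0$ be a domain in $\mathbb{R}^{p+1}$ and $f_0\in C^{\omega}(\Omega_0,\mathbb{A})$. Then, for odd $q\in\mathbb{N}$, the partial even part $\mathcal{PE}[\Delta_{\mathbf{x}}^{\frac{q-1}{2}}CK[f_0]]$ and the partial odd part $\mathcal{PO}[\Delta_{\mathbf{x}}^{\frac{q-1}{2}}CK[f_0]]$ are harmonic generalized partial-slice functions in an $(m+1)$-dimensional p-symmetric slice domain $\Omega$ in $M$ with $\Omega_0\subset\Omega$ (on which $CK[f_0]$ is generalized partial-slice monogenic).
   Context: Let $\mathbb{A}$ be a real alternative algebra (the associator $[a,b,c]=(ab)c-a(bc)$ is an alternating trilinear function) with unity $1$, of finite real dimension $d>1$, equipped with an anti-involution $a\mapsto a^c$ (real linear, $a^c=a$ for real $a$, $(a^c)^c=a$, $(ab)^c=b^ca^c$). Let $t(x)=x+x^c$, $n(x)=xx^c$, $\mathbb{S}_{\mathbb{A}}=\{x: t(x)=0,\ n(x)=1\}$ (assumed nonempty) and $Q_{\mathbb{A}}=\mathbb{R}\cup\{x: t(x)\in\mathbb{R},\ n(x)\in\mathbb{R},\ 4n(x)>t(x)^2\}$. Let $M$ be a real subspace with $\mathbb{R}\subsetneq M\subseteq Q_{\mathbb{A}}$ having a basis $(v_0,\dots,v_m)$, $m\ge1$, $v_0=1$, $v_s\in\mathbb{S}_{\mathbb{A}}$, $v_sv_t=-v_tv_s$ for distinct $s,t\ge1$; complete it to a basis of $\mathbb{A}$ with associated Euclidean norm. Identify $x=\sum x_sv_s\in M$ with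 $(x_0,\dots,x_m)\in\mathbb{R}^{m+1}$; differentiate componentwise; $C^\omega$ = componentwise real analytic. Fix $p\in\{0,\dots,m-1\}$, $q=m-p$; $\mathbf{x}=\mathbf{x}_p+\underline{\mathbf{x}}_q$ with $\mathbf{x}_p=\sum_{s=0}^px_sv_s\in\mathbb{R}^{p+1}$, $\underline{\mathbf{x}}_q=\sum_{s=p+1}^m x_sv_s$; $\mathbb{S}=\{\sum_{s=p+1}^m x_sv_s:\sum x_s^2=1\}$; $\underline{\mathbf{x}}_q=r\underline{\omega}$, $r=|\underline{\mathbf{x}}_q|$, $\underline{\omega}\in\mathbb{S}$. $D_{\mathbf{x}_p}f=\sum_{s=0}^p v_s\partial_{x_s}f$, $\Delta_{\mathbf{x}_p}=\sum_{s=0}^p\partial_{x_s}^2$, $\Delta_{\mathbf{x}}=\sum_{s=0}^m\partial_{x_s}^2$; harmonic means $\Delta_{\mathbf{x}}f=0$. $CK[f_0](\mathbf{x})=\sum_{k\ge0}\frac{r^{2k}}{(2k)!}(-\Delta_{\mathbf{x}_p})^kf_0(\mathbf{x}_p)+\underline{\omega}\sum_{k\ge0}\frac{r^{2k+1}}{(2k+1)!}(-\Delta_{\mathbf{x}_p})^k(D_{\mathbf{x}_p}f_0(\mathbf{x}_p))$. $f$ is left generalized partial-slice monogenic of type $(p,q)$ on $\Omega$ if for every $\underline{\omega}\in\mathbb{S}$ its restriction to $\Omega_{\underline{\omega}}=\Omega\cap(\mathbb{R}^{p+1}\oplus\underline{\omega}\mathbb{R})$ is $C^1$ and $(D_{\mathbf{x}_p}+\underline{\omega}\partial_r)f(\mathbf{x}_p+r\underline{\omega})=0$.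 A domain is a slice domain if $\Omega\cap\mathbb{R}^{p+1}\ne\emptyset$ and each $\Omega_{\underline{\omega}}$ is a domain in $\mathbb{R}^{p+2}$; p-symmetric if $\mathbf{x}_p+r\underline{\omega}\in\Omega$, $r>0$, implies $\mathbf{x}_p+r\underline{\eta}\in\Omega$ for all $\underline{\eta}\in\mathbb{S}$. A generalized partial-slice function on a p-symmetric set is one of the form $F_1(\mathbf{x}_p,r)+\underline{\omega}F_2(\mathbf{x}_p,r)$ with $F_1$ even and $F_2$ odd in $r$. For such $h$, with $\mathbf{x}_\diamond=\mathbf{x}_p-\underline{\mathbf{x}}_q$: $\mathcal{PE}[h](\mathbf{x})=\frac12(h(\mathbf{x})+h(\mathbf{x}_\diamond))$, $\mathcal{PO}[h](\mathbf{x})=\frac12(h(\mathbf{x})-h(\mathbf{x}_\diamond))$. *)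

theory Defs
  imports "HOL-Analysis.Analysis"
begin

text \<open>The real alternative algebra A is modelled as a finite-dimensional real
inner-product type 'a with a bilinear product mul, unit e and anti-involution cj.
Real numbers are identified with the multiples r *R e of the unit.\<close>

definition assoc :: "('a::real_vector \<Rightarrow> 'a \<Rightarrow> 'a) \<Rightarrow> 'a \<Rightarrow> 'a \<Rightarrow> 'a \<Rightarrow> 'a" where
  "assoc mul a b c = mul (mul a b) c - mul a (mul b c)"

definition alt_alg :: "('a::euclidean_space \<Rightarrow> 'a \<Rightarrow> 'a) \<Rightarrow> 'a \<Rightarrow> ('a \<Rightarrow> 'a) \<Rightarrow> bool" where
  "alt_alg mul e cj \<longleftrightarrow>
     bilinear mul \<and>
     (\<forall>a b. assoc mul a a b = 0 \<and> assoc mul a b a = 0 \<and> assoc mul b a a = 0) \<and>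
     (\<forall>x. mul e x = x \<and> mul x e = x) \<and>
     DIM('a) > 1 \<and>
     linear cj \<and> (\<forall>r. cj (r *\<^sub>R e) = r *\<^sub>R e) \<and> (\<forall>a. cj (cj a) = a) \<and>
     (\<forall>a b. cj (mul a b) = mul (cj b) (cj a))"

definition trc :: "('a::real_vector \<Rightarrow> 'a) \<Rightarrow> 'a \<Rightarrow> 'a" where
  "trc cj x = x + cj x"

definition nrm :: "('a \<Rightarrow> 'a \<Rightarrow> 'a) \<Rightarrow> ('a \<Rightarrow> 'a) \<Rightarrow> 'a \<Rightarrow> 'a" where
  "nrm mul cj x = mul x (cj x)"

definition SA :: "('a::real_vector \<Rightarrow> 'a \<Rightarrow> 'a) \<Rightarrow> 'a \<Rightarrow> ('a \<Rightarrow> 'a) \<Rightarrow> 'a set" where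
  "SA mul e cj = {x. trc cj x = 0 \<and> nrm mul cj x = e}"

definition QA :: "('a::real_vector \<Rightarrow> 'a \<Rightarrow> 'a) \<Rightarrow> 'a \<Rightarrow> ('a \<Rightarrow> 'a) \<Rightarrow> 'a set" where
  "QA mul e cj = range (\<lambda>r. r *\<^sub>R e) \<union>
     {x. \<exists>a b. trc cj x = a *\<^sub>R e \<and> nrm mul cj x = b *\<^sub>R e \<and> 4 * b > a\<^sup>2}"

definition slice_basis :: "('a::euclidean_space \<Rightarrow> 'a \<Rightarrow> 'a) \<Rightarrow> 'a \<Rightarrow> ('a \<Rightarrow> 'a) \<Rightarrow> (nat \<Rightarrow> 'a) \<Rightarrow> nat \<Rightarrow> bool" where
  "slice_basis mul e cj v m \<longleftrightarrow>
     1 \<le> m \<and> v 0 = e \<and> inj_on v {0..m} \<and> independent (v ` {0..m}) \<and>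
     (\<forall>s\<in>{1..m}. v s \<in> SA mul e cj) \<and>
     (\<forall>s\<in>{1..m}. \<forall>t\<in>{1..m}. s \<noteq> t \<longrightarrow> mul (v s) (v t) = - mul (v t) (v s)) \<and>
     span (v ` {0..m}) \<subseteq> QA mul e cj"

definition Mspace :: "(nat \<Rightarrow> 'a::real_vector) \<Rightarrow> nat \<Rightarrow> 'a set" where
  "Mspace v m = span (v ` {0..m})"

definition coords :: "(nat \<Rightarrow> 'a::real_vector) \<Rightarrow> nat \<Rightarrow> 'a \<Rightarrow> nat \<Rightarrow> real" where
  "coords v m x = (THE c. (\<forall>s. m < s \<longrightarrow> c s = 0) \<and> x = (\<Sum>s\<le>m. c s *\<^sub>R v s))"

definition xpart :: "(nat \<Rightarrow> 'a::real_vector) \<Rightarrow> nat \<Rightarrow> nat \<Rightarrow> 'a \<Rightarrow> 'a" where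
  "xpart v m p x = (\<Sum>s\<le>p. coords v m x s *\<^sub>R v s)"

definition xqpart :: "(nat \<Rightarrow> 'a::real_vector) \<Rightarrow> nat \<Rightarrow> nat \<Rightarrow> 'a \<Rightarrow> 'a" where
  "xqpart v m p x = (\<Sum>s\<in>{p+1..m}. coords v m x s *\<^sub>R v s)"

definition rad :: "(nat \<Rightarrow> 'a::real_vector) \<Rightarrow> nat \<Rightarrow> nat \<Rightarrow> 'a \<Rightarrow> real" where
  "rad v m p x = sqrt (\<Sum>s\<in>{p+1..m}. (coords v m x s)\<^sup>2)"

definition Sph :: "(nat \<Rightarrow> 'a::real_vector) \<Rightarrow> nat \<Rightarrow> nat \<Rightarrow> 'a set" where
  "Sph v m p = {(\<Sum>s\<in>{p+1..m}. c s *\<^sub>R v s) | c. (\<Sum>s\<in>{p+1..m}. (c s)\<^sup>2) = 1}"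

definition xdiamond :: "(nat \<Rightarrow> 'a::real_vector) \<Rightarrow> nat \<Rightarrow> nat \<Rightarrow> 'a \<Rightarrow> 'a" where
  "xdiamond v m p x = xpart v m p x - xqpart v m p x"

definition slice_plane :: "(nat \<Rightarrow> 'a::real_vector) \<Rightarrow> nat \<Rightarrow> 'a \<Rightarrow> 'a set" where
  "slice_plane v p \<omega> = span (insert \<omega> (v ` {0..p}))"

definition slice_of :: "(nat \<Rightarrow> 'a::real_vector) \<Rightarrow> nat \<Rightarrow> 'a set \<Rightarrow> 'a \<Rightarrow> 'a set" where
  "slice_of v p \<Omega> \<omega> = \<Omega> \<inter> slice_plane v p \<omega>"

definition p_symmetric :: "(nat \<Rightarrow> 'a::real_vector) \<Rightarrow> nat \<Rightarrow> nat \<Rightarrow> 'a set \<Rightarrow> bool" where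
  "p_symmetric v m p \<Omega> \<longleftrightarrow>
     (\<forall>xp\<in>Mspace v p. \<forall>r>0. \<forall>\<omega>\<in>Sph v m p. xp + r *\<^sub>R \<omega> \<in> \<Omega> \<longrightarrow>
        (\<forall>\<eta>\<in>Sph v m p. xp + r *\<^sub>R \<eta> \<in> \<Omega>))"

definition slice_domain :: "(nat \<Rightarrow> 'a::real_normed_vector) \<Rightarrow> nat \<Rightarrow> nat \<Rightarrow> 'a set \<Rightarrow> bool" where
  "slice_domain v m p \<Omega> \<longleftrightarrow>
     \<Omega> \<inter> Mspace v p \<noteq> {} \<and>
     (\<forall>\<omega>\<in>Sph v m p. slice_of v p \<Omega> \<omega> \<noteq> {} \<and>
        openin (top_of_set (slice_plane v p \<omega>)) (slice_of v p \<Omega> \<omega>) \<and>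
        connected (slice_of v p \<Omega> \<omega>))"

text \<open>Partial derivative of f in direction u (componentwise differentiation in the
coordinate x_s corresponds to the direction u = v s).\<close>
definition pd :: "'a::real_normed_vector \<Rightarrow> ('a \<Rightarrow> 'b::real_normed_vector) \<Rightarrow> 'a \<Rightarrow> 'b" where
  "pd u f x = vector_derivative (\<lambda>t. f (x + t *\<^sub>R u)) (at 0)"

definition has_pd :: "'a::real_normed_vector \<Rightarrow> ('a \<Rightarrow> 'b::real_normed_vector) \<Rightarrow> 'a \<Rightarrow> bool" where
  "has_pd u f x \<longleftrightarrow> (\<lambda>t. f (x + t *\<^sub>R u)) differentiable (at 0)"

fun Ck_dir :: "'a::real_normed_vector set \<Rightarrow> nat \<Rightarrow> 'a set \<Rightarrow> ('a \<Rightarrow> 'b::real_normed_vector) \<Rightarrow> bool" where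
  "Ck_dir U 0 \<Omega> f = continuous_on \<Omega> f"
| "Ck_dir U (Suc k) \<Omega> f =
     (continuous_on \<Omega> f \<and> (\<forall>u\<in>U. (\<forall>x\<in>\<Omega>. has_pd u f x) \<and> Ck_dir U k \<Omega> (pd u f)))"

definition lap_p :: "(nat \<Rightarrow> 'a::real_normed_vector) \<Rightarrow> nat \<Rightarrow> ('a \<Rightarrow> 'b::real_normed_vector) \<Rightarrow> 'a \<Rightarrow> 'b" where
  "lap_p v p f x = (\<Sum>s\<le>p. pd (v s) (pd (v s) f) x)"

definition D_p :: "('a::real_normed_vector \<Rightarrow> 'a \<Rightarrow> 'a) \<Rightarrow> (nat \<Rightarrow> 'a) \<Rightarrow> nat \<Rightarrow> ('a \<Rightarrow> 'a) \<Rightarrow> 'a \<Rightarrow> 'a" where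
  "D_p mul v p f x = (\<Sum>s\<le>p. mul (v s) (pd (v s) f x))"

definition harmonic_on :: "(nat \<Rightarrow> 'a::real_normed_vector) \<Rightarrow> nat \<Rightarrow> 'a set \<Rightarrow> ('a \<Rightarrow> 'b::real_normed_vector) \<Rightarrow> bool" where
  "harmonic_on v m \<Omega> f \<longleftrightarrow> Ck_dir (v ` {0..m}) 2 \<Omega> f \<and> (\<forall>x\<in>\<Omega>. lap_p v m f x = 0)"

definition real_analytic_on :: "(nat \<Rightarrow> 'a::real_normed_vector) \<Rightarrow> nat \<Rightarrow> 'a set \<Rightarrow> ('a \<Rightarrow> 'b::euclidean_space) \<Rightarrow> bool" where
  "real_analytic_on v p \<Omega>0 f \<longleftrightarrow>
     (\<forall>a\<in>\<Omega>0. \<exists>\<epsilon>>0. \<exists>c :: (nat \<Rightarrow> nat) \<Rightarrow> 'b.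
        \<forall>t :: nat \<Rightarrow> real. (\<Sum>s\<le>p. (t s)\<^sup>2) < \<epsilon>\<^sup>2 \<longrightarrow>
          a + (\<Sum>s\<le>p. t s *\<^sub>R v s) \<in> \<Omega>0 \<and>
          ((\<lambda>\<alpha>. (\<Prod>s\<le>p. t s ^ \<alpha> s) *\<^sub>R c \<alpha>) has_sum f (a + (\<Sum>s\<le>p. t s *\<^sub>R v s)))
            {\<alpha>. \<forall>i. p < i \<longrightarrow> \<alpha> i = 0})"

definition CK_even :: "(nat \<Rightarrow> 'a::real_normed_vector) \<Rightarrow> nat \<Rightarrow> nat \<Rightarrow> ('a \<Rightarrow> 'a) \<Rightarrow> 'a \<Rightarrow> nat \<Rightarrow> 'a" where
  "CK_even v m p f0 x k =
     (rad v m p x ^ (2*k) / fact (2*k)) *\<^sub>R ((\<lambda>g y. - lap_p v p g y) ^^ k) f0 (xpart v m p x)"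

definition CK_odd :: "('a::real_normed_vector \<Rightarrow> 'a \<Rightarrow> 'a) \<Rightarrow> (nat \<Rightarrow> 'a) \<Rightarrow> nat \<Rightarrow> nat \<Rightarrow> ('a \<Rightarrow> 'a) \<Rightarrow> 'a \<Rightarrow> nat \<Rightarrow> 'a" where
  "CK_odd mul v m p f0 x k =
     (rad v m p x ^ (2*k+1) / fact (2*k+1)) *\<^sub>R
        ((\<lambda>g y. - lap_p v p g y) ^^ k) (D_p mul v p f0) (xpart v m p x)"

text \<open>omega = x_q / r (any choice when r = 0 gives the same value, the odd series being 0).\<close>
definition CK :: "('a::real_normed_vector \<Rightarrow> 'a \<Rightarrow> 'a) \<Rightarrow> (nat \<Rightarrow> 'a) \<Rightarrow> nat \<Rightarrow> nat \<Rightarrow> ('a \<Rightarrow> 'a) \<Rightarrow> 'a \<Rightarrow> 'a" where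
  "CK mul v m p f0 x =
     suminf (CK_even v m p f0 x) +
     mul ((1 / rad v m p x) *\<^sub>R xqpart v m p x) (suminf (CK_odd mul v m p f0 x))"

definition gps_monogenic :: "('a::real_normed_vector \<Rightarrow> 'a \<Rightarrow> 'a) \<Rightarrow> (nat \<Rightarrow> 'a) \<Rightarrow> nat \<Rightarrow> nat \<Rightarrow> 'a set \<Rightarrow> ('a \<Rightarrow> 'a) \<Rightarrow> bool" where
  "gps_monogenic mul v m p \<Omega> f \<longleftrightarrow>
     (\<forall>\<omega>\<in>Sph v m p.
        Ck_dir (insert \<omega> (v ` {0..p})) 1 (slice_of v p \<Omega> \<omega>) f \<and>
        (\<forall>x\<in>slice_of v p \<Omega> \<omega>. D_p mul v p f x + mul \<omega> (pd \<omega> f x) = 0))"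

definition gps_function :: "('a::real_normed_vector \<Rightarrow> 'a \<Rightarrow> 'a) \<Rightarrow> (nat \<Rightarrow> 'a) \<Rightarrow> nat \<Rightarrow> nat \<Rightarrow> 'a set \<Rightarrow> ('a \<Rightarrow> 'a) \<Rightarrow> bool" where
  "gps_function mul v m p \<Omega> h \<longleftrightarrow>
     (\<exists>F1 F2 :: 'a \<Rightarrow> real \<Rightarrow> 'a.
        (\<forall>xp r. F1 xp (- r) = F1 xp r \<and> F2 xp (- r) = - F2 xp r) \<and>
        (\<forall>xp\<in>Mspace v p. \<forall>r. \<forall>\<omega>\<in>Sph v m p. xp + r *\<^sub>R \<omega> \<in> \<Omega> \<longrightarrow>
            h (xp + r *\<^sub>R \<omega>) = F1 xp r + mul \<omega> (F2 xp r)))"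

definition PE :: "(nat \<Rightarrow> 'a::real_vector) \<Rightarrow> nat \<Rightarrow> nat \<Rightarrow> ('a \<Rightarrow> 'a) \<Rightarrow> 'a \<Rightarrow> 'a" where
  "PE v m p h x = (1/2) *\<^sub>R (h x + h (xdiamond v m p x))"

definition PO :: "(nat \<Rightarrow> 'a::real_vector) \<Rightarrow> nat \<Rightarrow> nat \<Rightarrow> ('a \<Rightarrow> 'a) \<Rightarrow> 'a \<Rightarrow> 'a" where
  "PO v m p h x = (1/2) *\<^sub>R (h x - h (xdiamond v m p x))"

end

theory Submission
  imports Defs "HOL-Library.Multiset"
begin

text \<open>
Let \<open>w j k = 1 / ((2k)! (2k+1)(2k+3)...(2k+2j-1))\<close> (\<open>bessel_coeff\<close>) and, with \<open>R\<close> the squared radius,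
\<open>S j g = (\<Sum>k. w j k R^k (-\<Delta>_p)^k g)\<close> (\<open>bessel_series\<close>). Then \<open>CK[f0] = S 0 f0 + x_q S 1 (D f0)\<close>.
These series satisfy Bessel-type identities: the derivative of \<open>S j g\<close> in a coordinate \<open>x_s\<close>, \<open>s > p\<close>,
is \<open>x_s S (j+1) (-\<Delta>_p g)\<close>, and \<open>R S (j+2) (-\<Delta>_p g) = S j g - (2j+1) S (j+1) g\<close>. Hence
\<open>\<Delta> (S j g) = (q-1-2j) S (j+1) (-\<Delta>_p g)\<close> and \<open>\<Delta> (x_s S (j+1) g) = (q-1-2j) x_s S (j+2) (-\<Delta>_p g)\<close>,
so the even and odd parts of \<open>\<Delta>^i CK[f0]\<close> carry the factor \<open>(q-1)(q-3)...(q+1-2i)\<close>, which vanishes for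
\<open>i = (q+1)/2\<close>. Convergence and termwise differentiation rest on the Cauchy estimates of the real analytic \<open>f0\<close>.
\<close>

text \<open>Two obstacles shape the proof. \<open>\<Omega>0\<close> and the final domain are open
  only in subspaces of the algebra. Dual functionals \<open>\<xi> s\<close> on the whole algebra
  extend all functions cylindrically, so that the calculus uses Frechet derivatives on an open set
  \<open>V\<close>; the partial derivatives \<open>pd\<close> are recovered afterwards, since they
  depend only on germs along lines inside M. The second obstacle is nonassociativity: v_s (v_t a)
  cannot be regrouped. Only the operators of left multiplication by the v_s are used, and polarising
  the left alternative law makes them satisfy the Clifford relations. If \<Delta>_p g = g, then S j
  g is g times sqrt(pi/2) r^(1/2-j) J_(j-1/2)(r), which is cos r for j = 0 and sin(r)/r for j = 1. A
  coordinate factor x_s with s > p makes the radial Laplacian act as in dimension q + 2 instead of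
  q. Together with the series index raised by one this yields the same scalar factor for the odd
  part as for the even part.\<close>

section \<open>Power series\<close>

text \<open>All derivatives are combinations of the same finitely many functionals
  \<open>w i\<close>. Uniform convergence of the derivative operators therefore reduces to the
  Weierstrass test for each coefficient sequence \<open>D i\<close>.\<close>

lemma has_derivative_suminf_gradient:
  fixes f :: "nat \<Rightarrow> 'a::real_normed_vector \<Rightarrow> 'b::banach"
  assumes I: "finite I" and w: "\<And>i. i \<in> I \<Longrightarrow> bounded_linear (w i)" and V: "open V" "x \<in> V"
    and f: "\<And>n x. x \<in> V \<Longrightarrow> (f n has_derivative (\<lambda>h. \<Sum>i\<in>I. w i h *\<^sub>R D i n x)) (at x)"
    and D: "\<And>i n x. i \<in> I \<Longrightarrow> x \<in> V \<Longrightarrow> norm (D i n x) \<le> B n" and B: "summable B"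
    and sf: "\<And>x. x \<in> V \<Longrightarrow> summable (\<lambda>n. f n x)"
  shows "((\<lambda>x. \<Sum>n. f n x) has_derivative (\<lambda>h. \<Sum>i\<in>I. w i h *\<^sub>R (\<Sum>n. D i n x))) (at x)"
proof -
  obtain r where r: "r > 0" "ball x r \<subseteq> V"
    using V open_contains_ball by blast
  have "\<forall>i\<in>I. \<exists>K\<ge>0. \<forall>h. \<bar>w i h\<bar> \<le> norm h * K"
    using bounded_linear.nonneg_bounded[OF w] by (metis real_norm_def)
  then obtain K where K: "\<And>i. i \<in> I \<Longrightarrow> K i \<ge> 0" "\<And>i h. i \<in> I \<Longrightarrow> \<bar>w i h\<bar> \<le> norm h * K i"
    by metis
  have u: "uniform_limit V (\<lambda>n x. \<Sum>k<n. D i k x) (\<lambda>x. \<Sum>k. D i k x) sequentially" if "i \<in> I" for i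
    using Weierstrass_m_test[of V "D i" B] D[OF that] B by simp
  have ev: "\<forall>\<^sub>F n in sequentially. \<forall>y\<in>ball x r. \<forall>h.
      norm ((\<Sum>k<n. \<Sum>i\<in>I. w i h *\<^sub>R D i k y) - (\<Sum>i\<in>I. w i h *\<^sub>R (\<Sum>k. D i k y))) \<le> e * norm h"
    if e: "e > 0" for e
  proof -
    \<comment> \<open>The added 1 keeps the denominator positive when all \<open>K i\<close>
      vanish.\<close>
    define d where "d = e / (1 + (\<Sum>i\<in>I. K i))"
    have s0: "(\<Sum>i\<in>I. K i) \<ge> 0" using K by (simp add: sum_nonneg)
    have d: "d > 0" using e s0 by (simp add: d_def)
    have "\<forall>\<^sub>F n in sequentially. \<forall>i\<in>I. \<forall>y\<in>V. dist (\<Sum>k<n. D i k y) (\<Sum>k. D i k y) < d"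
      using I u d by (auto simp: eventually_ball_finite_distrib uniform_limit_iff)
    then show ?thesis
    proof (eventually_elim, intro ballI allI)
      fix n y h
      assume n: "\<forall>i\<in>I. \<forall>y\<in>V. dist (\<Sum>k<n. D i k y) (\<Sum>k. D i k y) < d" and y: "y \<in> ball x r"
      have "(\<Sum>k<n. \<Sum>i\<in>I. w i h *\<^sub>R D i k y) = (\<Sum>i\<in>I. w i h *\<^sub>R (\<Sum>k<n. D i k y))"
        by (subst sum.swap) (simp add: scaleR_sum_right)
      then have "norm ((\<Sum>k<n. \<Sum>i\<in>I. w i h *\<^sub>R D i k y) - (\<Sum>i\<in>I. w i h *\<^sub>R (\<Sum>k. D i k y))) =
          norm (\<Sum>i\<in>I. w i h *\<^sub>R ((\<Sum>k<n. D i k y) - (\<Sum>k. D i k y)))"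
        by (simp add: sum_subtractf scaleR_diff_right)
      also have "\<dots> \<le> (\<Sum>i\<in>I. (norm h * K i) * d)"
      proof (rule sum_norm_le)
        fix i assume i: "i \<in> I"
        then have "norm ((\<Sum>k<n. D i k y) - (\<Sum>k. D i k y)) \<le> d"
          using n y r by (force simp: dist_norm)
        then show "norm (w i h *\<^sub>R ((\<Sum>k<n. D i k y) - (\<Sum>k. D i k y))) \<le> (norm h * K i) * d"
          using K[OF i] by (auto intro!: mult_mono)
      qed
      also have "\<dots> = norm h * d * (\<Sum>i\<in>I. K i)"
        by (simp add: sum_distrib_left mult_ac)
      also have "\<dots> \<le> norm h * d * (1 + (\<Sum>i\<in>I. K i))"
        using d by (intro mult_left_mono) auto
      also have "\<dots> = e * norm h" using s0 by (simp add: d_def)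
      finally show "norm ((\<Sum>k<n. \<Sum>i\<in>I. w i h *\<^sub>R D i k y) - (\<Sum>i\<in>I. w i h *\<^sub>R (\<Sum>k. D i k y))) \<le> e * norm h" .
    qed
  qed
  have "\<exists>g. \<forall>y\<in>ball x r. (\<lambda>n. f n y) sums (g y) \<and>
      (g has_derivative (\<lambda>h. \<Sum>i\<in>I. w i h *\<^sub>R (\<Sum>n. D i n y))) (at y within ball x r)"
  proof (rule has_derivative_series[where x = x and l = "\<Sum>n. f n x"])
    show "(f n has_derivative (\<lambda>h. \<Sum>i\<in>I. w i h *\<^sub>R D i n y)) (at y within ball x r)" if "y \<in> ball x r" for n y
      using f r that by (blast intro: has_derivative_at_withinI)
  qed (use ev r sf V in auto)
  moreover have "x \<in> ball x r" using r by simp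
  ultimately obtain g where g: "\<And>y. y \<in> ball x r \<Longrightarrow> (\<lambda>n. f n y) sums (g y)"
     "(g has_derivative (\<lambda>h. \<Sum>i\<in>I. w i h *\<^sub>R (\<Sum>n. D i n x))) (at x within ball x r)"
    by blast
  then have "(g has_derivative (\<lambda>h. \<Sum>i\<in>I. w i h *\<^sub>R (\<Sum>n. D i n x))) (at x)"
    using at_within_open[of x "ball x r"] r by simp
  then show ?thesis
    by (rule has_derivative_transform_within_open[OF _ open_ball[of x r]])
       (use r g in \<open>auto simp: sums_iff\<close>)
qed

text \<open>In finite dimension the claim reduces to the real coordinates, because the norm is at
  most the sum of their absolute values. It turns the \<open>has_sum\<close> in
  \<open>real_analytic_on\<close> into a majorant.\<close>

lemma summable_on_euclidean_imp_abs_summable_on: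
  fixes f :: "'i \<Rightarrow> 'b::euclidean_space"
  assumes "f summable_on A"
  shows "(\<lambda>i. norm (f i)) summable_on A"
proof (rule Infinite_Sum.abs_summable_on_comparison_test')
  have "(\<lambda>i. \<bar>f i \<bullet> b\<bar>) summable_on A" for b
    using summable_on_bounded_linear[OF bounded_linear_inner_left assms, of b]
      summable_on_iff_abs_summable_on_real by (metis (no_types, lifting) real_norm_def summable_on_cong)
  then have "(\<lambda>i. \<Sum>b\<in>B. \<bar>f i \<bullet> b\<bar>) summable_on A" for B
    by (induction B rule: infinite_finite_induct) (auto intro: summable_on_add)
  then show "(\<lambda>i. \<Sum>b\<in>Basis. \<bar>f i \<bullet> b\<bar>) summable_on A" .
qed (rule norm_le_l1)

section \<open>Derivatives of monomials, multi-indices and factorial estimates\<close>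

text \<open>The \<open>b\<close>-th derivative of t^N, with the falling factorial written as b!
  times a binomial coefficient. In this form it is zero for b > N and can be bounded through
  2^N.\<close>

definition monomial_deriv :: "nat \<Rightarrow> nat \<Rightarrow> real \<Rightarrow> real" where
  "monomial_deriv N b t = fact b * real (N choose b) * t ^ (N - b)"

lemma monomial_deriv_0 [simp]: "monomial_deriv N 0 t = t ^ N"
  by (simp add: monomial_deriv_def)

lemma monomial_deriv_Suc: "monomial_deriv N (Suc b) t = fact b * real (N choose b) * (real (N - b) * t ^ (N - b - 1))"
proof -
  have "Suc b * (N choose Suc b) = (N - b) * (N choose b)"
    by (metis binomial_absorb_comp binomial_absorption)
  then have "real (Suc b) * real (N choose Suc b) = real (N - b) * real (N choose b)"
    by (metis of_nat_mult)
  then show ?thesis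
    by (simp add: monomial_deriv_def algebra_simps del: of_nat_Suc) 
qed

lemma monomial_deriv_has_field_derivative: "(monomial_deriv N b has_real_derivative monomial_deriv N (Suc b) t) (at t)"
  unfolding monomial_deriv_Suc unfolding monomial_deriv_def[abs_def] by (auto intro!: derivative_eq_intros)

text \<open>A Cauchy estimate by real means: the binomial coefficient is at most 2^N, so
  \<open>b\<close> differentiations cost b!/\<sigma>^b and a doubling of the radius.\<close>

lemma monomial_deriv_bound:
  assumes "\<sigma> > 0" "\<bar>t\<bar> \<le> \<sigma>"
  shows "\<bar>monomial_deriv N b t\<bar> \<le> (2 * \<sigma>) ^ N * (fact b * (1 / \<sigma>) ^ b)"
proof (cases "b \<le> N")
  case True
  have "\<bar>monomial_deriv N b t\<bar> = fact b * real (N choose b) * \<bar>t\<bar> ^ (N - b)"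
    by (simp add: monomial_deriv_def abs_mult power_abs)
  also have "\<dots> \<le> fact b * 2 ^ N * \<sigma> ^ (N - b)"
    using assms of_nat_mono[OF binomial_le_pow2[of N b], where 'a=real] by (intro mult_mono power_mono) auto
  also have "\<dots> = (2 * \<sigma>) ^ N * (fact b * (1 / \<sigma>) ^ b)"
    using True assms by (simp add: power_diff power_mult_distrib power_divide)
  finally show ?thesis .
next
  case False
  then show ?thesis using assms by (simp add: monomial_deriv_def binomial_eq_0)
qed

lemma infinite_multi_indices: "infinite {\<alpha>::nat \<Rightarrow> nat. \<forall>i. p < i \<longrightarrow> \<alpha> i = 0}"
proof
  assume "finite {\<alpha>::nat \<Rightarrow> nat. \<forall>i. p < i \<longrightarrow> \<alpha> i = 0}"
  moreover have "range (\<lambda>n i. if i = 0 then n else 0) \<subseteq> {\<alpha>::nat \<Rightarrow> nat. \<forall>i. p < i \<longrightarrow> \<alpha> i = 0}"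
    by auto
  ultimately have "finite (range (\<lambda>n i::nat. if i = 0 then n else (0::nat)))"
    by (rule rev_finite_subset)
  moreover have "inj (\<lambda>n i::nat. if i = 0 then n else (0::nat))"
    by (auto simp: inj_def dest!: fun_cong[where x = 0])
  ultimately show False
    using finite_imageD infinite_UNIV_nat by blast
qed

lemma countable_multi_indices: "countable {\<alpha>::nat \<Rightarrow> nat. \<forall>i. p < i \<longrightarrow> \<alpha> i = 0}"
proof -
  have "countable ((\<lambda>\<alpha>. restrict \<alpha> {..p}) ` {\<alpha>::nat \<Rightarrow> nat. \<forall>i. p < i \<longrightarrow> \<alpha> i = 0})"
    by (rule countable_subset[OF _ countable_PiE[of "{..p}" "\<lambda>_. UNIV"]]) (auto simp: PiE_def)
  moreover have "inj_on (\<lambda>\<alpha>. restrict \<alpha> {..p}) {\<alpha>::nat \<Rightarrow> nat. \<forall>i. p < i \<longrightarrow> \<alpha> i = 0}"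
  proof (rule inj_onI, rule ext)
    fix \<alpha> \<beta> :: "nat \<Rightarrow> nat" and i
    assume "\<alpha> \<in> {\<alpha>. \<forall>i. p < i \<longrightarrow> \<alpha> i = 0}" "\<beta> \<in> {\<alpha>. \<forall>i. p < i \<longrightarrow> \<alpha> i = 0}"
      and eq: "restrict \<alpha> {..p} = restrict \<beta> {..p}"
    then show "\<alpha> i = \<beta> i"
      by (cases "i \<le> p") (auto dest: fun_cong[where x = i] simp: restrict_def)
  qed
  ultimately show ?thesis by (rule countable_image_inj_on)
qed

text \<open>Multinomial coefficients are at least 1. Entries of \<beta> above \<open>p\<close> count
  only on the right side, where K \<ge> 1 keeps the inequality.\<close>

lemma prod_fact_count_le:
  fixes K :: real and p :: nat assumes "K \<ge> 1"
  shows "(\<Prod>s\<le>p. fact (count \<beta> s) * K ^ count \<beta> s) \<le> fact (size \<beta>) * K ^ size \<beta>"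
proof (induction \<beta>)
  case (add s \<beta>)
  let ?t = "\<lambda>\<beta> s. fact (count \<beta> s) * K ^ count \<beta> s"
  have pos: "?t \<beta> i \<ge> 0" for \<beta> and i :: nat using assms by simp
  have K0: "real (Suc (size \<beta>)) * K \<ge> 1"
    using mult_mono[of 1 "real (Suc (size \<beta>))" 1 K] assms by simp
  have "(\<Prod>i\<le>p. ?t (add_mset s \<beta>) i) \<le> (real (Suc (size \<beta>)) * K) * (\<Prod>i\<le>p. ?t \<beta> i)"
  proof (cases "s \<le> p")
    case True
    have "(\<Prod>i\<in>{..p} - {s}. ?t (add_mset s \<beta>) i) = (\<Prod>i\<in>{..p} - {s}. ?t \<beta> i)"
      by (rule prod.cong) auto
    moreover have "(\<Prod>i\<le>p. ?t (add_mset s \<beta>) i) = ?t (add_mset s \<beta>) s * (\<Prod>i\<in>{..p} - {s}. ?t (add_mset s \<beta>) i)"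
      using True by (intro prod.remove) auto
    ultimately have "(\<Prod>i\<le>p. ?t (add_mset s \<beta>) i) = ?t (add_mset s \<beta>) s * (\<Prod>i\<in>{..p} - {s}. ?t \<beta> i)"
      by simp
    also have "\<dots> = (real (Suc (count \<beta> s)) * K) * (?t \<beta> s * (\<Prod>i\<in>{..p} - {s}. ?t \<beta> i))"
      by (simp add: algebra_simps)
    also have "?t \<beta> s * (\<Prod>i\<in>{..p} - {s}. ?t \<beta> i) = (\<Prod>i\<le>p. ?t \<beta> i)"
      using True by (intro prod.remove[symmetric]) auto
    also have "(real (Suc (count \<beta> s)) * K) * (\<Prod>i\<le>p. ?t \<beta> i) \<le> (real (Suc (size \<beta>)) * K) * (\<Prod>i\<le>p. ?t \<beta> i)"
      using assms count_le_size[of \<beta> s] by (intro mult_right_mono prod_nonneg) auto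
    finally show ?thesis .
  next
    case False
    then have "(\<Prod>i\<le>p. ?t (add_mset s \<beta>) i) = (\<Prod>i\<le>p. ?t \<beta> i)"
      by (intro prod.cong) auto
    then show ?thesis
      using mult_right_mono[OF K0, of "\<Prod>i\<le>p. ?t \<beta> i"] pos by (simp add: prod_nonneg del: of_nat_Suc)
  qed
  also have "\<dots> \<le> (real (Suc (size \<beta>)) * K) * (fact (size \<beta>) * K ^ size \<beta>)"
    using add K0 by (intro mult_left_mono) auto
  finally show ?case by (simp add: algebra_simps)
qed simp

section \<open>Coordinates and real analyticity\<close>

text \<open>Coordinates are taken as linear functionals on the whole space instead of the
  description in \<open>coords\<close>, so that they can be differentiated at every point.
  \<open>coords_eq\<close> identifies the two on M.\<close>

locale coordinate_frame =
  fixes v :: "nat \<Rightarrow> 'a::euclidean_space" and m p :: nat and \<xi> :: "nat \<Rightarrow> 'a \<Rightarrow> real"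
  assumes p_less_m: "p < m"
    and linear_\<xi>: "\<And>s. linear (\<xi> s)"
    and \<xi>_v: "\<And>s t. s \<le> m \<Longrightarrow> t \<le> m \<Longrightarrow> \<xi> s (v t) = (if s = t then 1 else 0)"
begin

lemma bounded_linear_\<xi>: "bounded_linear (\<xi> s)"
  by (simp add: linear_\<xi> linear_conv_bounded_linear[symmetric])

lemma \<xi>_simps [simp]:
  "\<xi> s (x + y) = \<xi> s x + \<xi> s y" "\<xi> s (x - y) = \<xi> s x - \<xi> s y" "\<xi> s (- x) = - \<xi> s x"
  "\<xi> s (c *\<^sub>R x) = c * \<xi> s x" "\<xi> s 0 = 0" "\<xi> s (\<Sum>i\<in>A. g i) = (\<Sum>i\<in>A. \<xi> s (g i))"
  using linear_\<xi>[of s] by (simp_all add: linear_add linear_diff linear_neg linear_cmul linear_0 linear_sum)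

lemma \<xi>_derivative [derivative_intros]:
  "(f has_derivative f') (at x within A) \<Longrightarrow> ((\<lambda>x. \<xi> s (f x)) has_derivative (\<lambda>h. \<xi> s (f' h))) (at x within A)"
  by (rule bounded_linear.has_derivative[OF bounded_linear_\<xi>])

lemma continuous_on_\<xi> [continuous_intros]:
  "continuous_on A f \<Longrightarrow> continuous_on A (\<lambda>x. \<xi> s (f x))"
  by (rule bounded_linear.continuous_on[OF bounded_linear_\<xi>])

definition proj :: "'a \<Rightarrow> 'a" where
  "proj x = (\<Sum>s\<le>p. \<xi> s x *\<^sub>R v s)"

definition rad2 :: "'a \<Rightarrow> real" where
  "rad2 x = (\<Sum>s\<in>{p+1..m}. (\<xi> s x)\<^sup>2)"

text \<open>A cube in the first p + 1 coordinates and no restriction otherwise, hence open in the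
  whole algebra. The bound on x_q is imposed separately in \<open>V\<close>.\<close>

definition cylinder :: "'a \<Rightarrow> real \<Rightarrow> 'a set" where
  "cylinder a \<sigma> = {x. \<forall>s\<le>p. \<bar>\<xi> s (x - a)\<bar> < \<sigma>}"

lemma open_cylinder: "open (cylinder a \<sigma>)"
proof -
  have "cylinder a \<sigma> = (\<Inter>s\<le>p. {x. \<bar>\<xi> s (x - a)\<bar> < \<sigma>})"
    by (auto simp: cylinder_def)
  then show ?thesis
    by (simp only:) (intro open_INT finite_atMost ballI open_Collect_less continuous_intros)
qed

lemma rad2_nonneg: "rad2 x \<ge> 0"
  by (simp add: rad2_def sum_nonneg)

lemma proj_simps [simp]:
  "proj (x + y) = proj x + proj y" "proj (x - y) = proj x - proj y" "proj (c *\<^sub>R x) = c *\<^sub>R proj x"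
  by (simp_all add: proj_def algebra_simps sum.distrib sum_subtractf scaleR_sum_right)

lemma proj_v: "s \<le> m \<Longrightarrow> proj (v s) = (if s \<le> p then v s else 0)"
proof -
  assume s: "s \<le> m"
  have "proj (v s) = (\<Sum>t\<le>p. if t = s then v s else 0)"
    unfolding proj_def using s p_less_m by (intro sum.cong) (auto simp: \<xi>_v)
  then show ?thesis by simp
qed

section \<open>Formal families of iterated partial derivatives\<close>

abbreviation gradient_at :: "nat \<Rightarrow> ('a \<Rightarrow> 'b::real_normed_vector) \<Rightarrow> (nat \<Rightarrow> 'b) \<Rightarrow> 'a \<Rightarrow> bool" where
  "gradient_at n f D x \<equiv> (f has_derivative (\<lambda>h. \<Sum>i\<le>n. \<xi> i h *\<^sub>R D i)) (at x)"

text \<open>Purely formal: -\<Delta>_p acts on the index by adding \<open>s\<close> twice. The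
  analytic meaning comes from \<open>family\<close>.\<close>

definition lapF :: "(nat multiset \<Rightarrow> 'a \<Rightarrow> 'a) \<Rightarrow> nat multiset \<Rightarrow> 'a \<Rightarrow> 'a" where
  "lapF F \<beta> x = - (\<Sum>s\<le>p. F (add_mset s (add_mset s \<beta>)) x)"

text \<open>\<open>F \<beta>\<close> stands for the iterated partial derivative of \<open>F {#}\<close> along the directions in \<open>\<beta>\<close>; indexing by
multisets builds in the symmetry of mixed partials. The bound makes \<open>\<Sum>k. r^(2k)/(2k)! |\<Delta>^k F \<beta>|\<close> converge for \<open>r\<^sup>2 < 1/L\<close>.\<close>

definition family :: "'a set \<Rightarrow> real \<Rightarrow> (nat multiset \<Rightarrow> 'a \<Rightarrow> 'a) \<Rightarrow> bool" where
  "family U L F \<longleftrightarrow>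
     (\<forall>\<beta>. \<forall>x\<in>U. gradient_at p (F \<beta>) (\<lambda>s. F (add_mset s \<beta>) x) x) \<and>
     (\<forall>\<beta>. \<exists>M\<ge>0. \<forall>k. \<forall>x\<in>U. norm ((lapF ^^ k) F \<beta> x) \<le> M * fact (2 * k) * L ^ k)"

text \<open>Each \<open>lapF\<close> costs p + 1 summands and two more derivatives, and (|\<beta>| +
  2k)! is at most |\<beta>|! (2k)! 2^(|\<beta>| + 2k). The factors with exponent k combine to the
  rate (p + 1)(2K)^2; the rest goes into the constant belonging to \<beta>.\<close>

lemma familyI_bound:
  fixes K M :: real
  assumes grad: "\<And>\<beta> x. x \<in> U \<Longrightarrow> gradient_at p (F \<beta>) (\<lambda>s. F (add_mset s \<beta>) x) x"
    and bound: "\<And>\<beta> x. x \<in> U \<Longrightarrow> norm (F \<beta> x) \<le> M * (fact (size \<beta>) * K ^ size \<beta>)"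
    and K: "K \<ge> 0" and M: "M \<ge> 0"
  shows "family U (real (p + 1) * (4 * K\<^sup>2)) F"
proof -
  have 1: "norm ((lapF ^^ k) F \<beta> x) \<le> real (p + 1) ^ k * (M * (fact (size \<beta> + 2 * k) * K ^ (size \<beta> + 2 * k)))"
    if "x \<in> U" for k \<beta> x
  proof (induction k arbitrary: \<beta>)
    case 0
    then show ?case using bound that by simp
  next
    case (Suc k)
    have "norm ((lapF ^^ Suc k) F \<beta> x) \<le> (\<Sum>s\<le>p. norm ((lapF ^^ k) F (add_mset s (add_mset s \<beta>)) x))"
      by (simp add: lapF_def norm_sum)
    also have "\<dots> \<le> (\<Sum>s\<le>p. real (p + 1) ^ k * (M * (fact (size \<beta> + 2 * Suc k) * K ^ (size \<beta> + 2 * Suc k))))"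
      using Suc.IH[of "add_mset s (add_mset s \<beta>)" for s] by (intro sum_mono) simp
    finally show ?case by (simp add: algebra_simps)
  qed
  have 2: "norm ((lapF ^^ k) F \<beta> x) \<le> M * fact (size \<beta>) * (2 * K) ^ size \<beta> * fact (2 * k) * (real (p + 1) * (4 * K\<^sup>2)) ^ k"
    if "x \<in> U" for k \<beta> x
  proof -
    have "fact (size \<beta> + 2 * k) = (fact (size \<beta>) * fact (2 * k) * real ((size \<beta> + 2 * k) choose size \<beta>))"
      using binomial_fact_lemma[of "size \<beta>" "size \<beta> + 2 * k", THEN arg_cong[where f = real]]
      by (simp del: binomial_fact_lemma)
    also have "\<dots> \<le> fact (size \<beta>) * fact (2 * k) * 2 ^ (size \<beta> + 2 * k)"
      using of_nat_mono[OF binomial_le_pow2[of "size \<beta> + 2 * k" "size \<beta>"], where 'a=real]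
      by (intro mult_left_mono) auto
    finally have "real (p + 1) ^ k * (M * (fact (size \<beta> + 2 * k) * K ^ (size \<beta> + 2 * k)))
      \<le> real (p + 1) ^ k * (M * ((fact (size \<beta>) * fact (2 * k) * 2 ^ (size \<beta> + 2 * k)) * K ^ (size \<beta> + 2 * k)))"
      using K M by (intro mult_left_mono mult_right_mono) auto
    also have "\<dots> = M * fact (size \<beta>) * (2 * K) ^ size \<beta> * fact (2 * k) * (real (p + 1) * (4 * K\<^sup>2)) ^ k"
    proof -
      have "2 ^ (2 * k) = (4::real) ^ k" "K ^ (2 * k) = K\<^sup>2 ^ k"
        by (simp_all only: power_mult) simp
      then show ?thesis by (simp only: power_mult_distrib power_add mult_ac)
    qed
    finally show ?thesis using 1[OF that] by (rule order_trans[rotated])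
  qed
  show ?thesis
    unfolding family_def using grad 2 K M
    by (intro conjI allI ballI exI[of _ "M * fact (size _) * (2 * K) ^ size _"]) auto
qed

text \<open>The rate \<open>L\<close> survives because iterates of \<open>lapF F\<close> at \<beta>
  are finite sums of iterates of \<open>F\<close> at larger indices, and \<open>family\<close> lets
  only the constant \<open>M\<close> depend on the index. Hence all later series converge on one
  common domain.\<close>

lemma family_lapF:
  assumes "family U L F"
  shows "family U L (lapF F)"
  unfolding family_def
proof (intro conjI allI ballI)
  fix \<beta> x assume x: "x \<in> U"
  have "(lapF F \<beta> has_derivative (\<lambda>h. - (\<Sum>s\<le>p. \<Sum>i\<le>p. \<xi> i h *\<^sub>R F (add_mset i (add_mset s (add_mset s \<beta>))) x))) (at x)"
    unfolding lapF_def[abs_def] using assms x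
    by (intro has_derivative_minus has_derivative_sum) (auto simp: family_def)
  moreover have "(\<lambda>h. - (\<Sum>s\<le>p. \<Sum>i\<le>p. \<xi> i h *\<^sub>R F (add_mset i (add_mset s (add_mset s \<beta>))) x)) =
    (\<lambda>h. \<Sum>i\<le>p. \<xi> i h *\<^sub>R lapF F (add_mset i \<beta>) x)"
    unfolding lapF_def by (subst sum.swap) (simp add: scaleR_sum_right sum_negf add_mset_commute)
  ultimately show "gradient_at p (lapF F \<beta>) (\<lambda>s. lapF F (add_mset s \<beta>) x) x" by simp
next
  fix \<beta>
  have "\<forall>s. \<exists>M\<ge>0. \<forall>k. \<forall>x\<in>U. norm ((lapF ^^ k) F (add_mset s (add_mset s \<beta>)) x) \<le> M * fact (2 * k) * L ^ k"
    using assms by (simp add: family_def)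
  then obtain M where M: "\<And>s. M s \<ge> 0"
    "\<And>s k x. x \<in> U \<Longrightarrow> norm ((lapF ^^ k) F (add_mset s (add_mset s \<beta>)) x) \<le> M s * fact (2 * k) * L ^ k" by metis
  have "norm ((lapF ^^ k) (lapF F) \<beta> x) \<le> (\<Sum>s\<le>p. M s) * fact (2 * k) * L ^ k" if "x \<in> U" for k x
  proof -
    have "(lapF ^^ k) (lapF F) \<beta> x = - (\<Sum>s\<le>p. (lapF ^^ k) F (add_mset s (add_mset s \<beta>)) x)"
      by (simp flip: funpow_swap1 add: lapF_def)
    also have "norm \<dots> \<le> (\<Sum>s\<le>p. M s * fact (2 * k) * L ^ k)"
      using M that by (simp add: sum_norm_le)
    finally show ?thesis by (simp add: sum_distrib_right)
  qed
  then show "\<exists>M\<ge>0. \<forall>k. \<forall>x\<in>U. norm ((lapF ^^ k) (lapF F) \<beta> x) \<le> M * fact (2 * k) * L ^ k"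
    using M(1) by (intro exI[of _ "\<Sum>s\<le>p. M s"]) (auto intro: sum_nonneg)
qed

lemma family_lapF_power: "family U L F \<Longrightarrow> family U L ((lapF ^^ k) F)"
  by (induction k) (auto intro: family_lapF)

lemma lapF_power_shift: "(lapF ^^ k) (\<lambda>\<beta>. F (add_mset s \<beta>)) = (\<lambda>\<beta>. (lapF ^^ k) F (add_mset s \<beta>))"
  by (induction k) (auto simp: lapF_def add_mset_commute fun_eq_iff)

lemma family_shift:
  assumes "family U L F"
  shows "family U L (\<lambda>\<beta>. F (add_mset s \<beta>))"
  using assms by (simp add: family_def lapF_power_shift add_mset_commute)

lemma lapF_power_lin:
  assumes "\<And>i. i \<in> A \<Longrightarrow> linear (T i)"
  shows "(lapF ^^ k) (\<lambda>\<beta> x. \<Sum>i\<in>A. T i (F i \<beta> x)) = (\<lambda>\<beta> x. \<Sum>i\<in>A. T i ((lapF ^^ k) (F i) \<beta> x))"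
proof (induction k)
  case (Suc k)
  have "(\<Sum>i\<in>A. T i ((lapF ^^ Suc k) (F i) \<beta> x)) =
     - (\<Sum>s\<le>p. \<Sum>i\<in>A. T i ((lapF ^^ k) (F i) (add_mset s (add_mset s \<beta>)) x))" for \<beta> x
    by (subst sum.swap) (simp add: lapF_def linear_neg[OF assms] linear_sum[OF assms] sum_negf)
  then show ?case
    unfolding funpow.simps o_def Suc by (simp add: lapF_def[abs_def])
qed simp

text \<open>Needed for D f0, whose summands are left multiplications applied to partial
  derivatives.\<close>

lemma family_lin:
  assumes A: "finite A" and F: "\<And>i. i \<in> A \<Longrightarrow> family U L (F i)" and T: "\<And>i. i \<in> A \<Longrightarrow> linear (T i)"
    and L: "L \<ge> 0"
  shows "family U L (\<lambda>\<beta> x. \<Sum>i\<in>A. T i (F i \<beta> x))"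
  unfolding family_def
proof (intro conjI allI ballI)
  fix \<beta> x assume x: "x \<in> U"
  have bl: "bounded_linear (T i)" if "i \<in> A" for i
    using T[OF that] linear_conv_bounded_linear by blast
  have "((\<lambda>x. \<Sum>i\<in>A. T i (F i \<beta> x)) has_derivative (\<lambda>h. \<Sum>i\<in>A. T i (\<Sum>s\<le>p. \<xi> s h *\<^sub>R F i (add_mset s \<beta>) x))) (at x)"
    using F x by (intro has_derivative_sum bounded_linear.has_derivative[OF bl]) (auto simp: family_def)
  moreover have "(\<Sum>i\<in>A. T i (\<Sum>s\<le>p. \<xi> s h *\<^sub>R F i (add_mset s \<beta>) x)) =
    (\<Sum>s\<le>p. \<xi> s h *\<^sub>R (\<Sum>i\<in>A. T i (F i (add_mset s \<beta>) x)))" for h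
  proof -
    have "(\<Sum>i\<in>A. T i (\<Sum>s\<le>p. \<xi> s h *\<^sub>R F i (add_mset s \<beta>) x)) =
      (\<Sum>i\<in>A. \<Sum>s\<le>p. \<xi> s h *\<^sub>R T i (F i (add_mset s \<beta>) x))"
      by (simp add: linear_sum[OF T] linear_cmul[OF T])
    then show ?thesis by (simp add: sum.swap[of _ A] scaleR_sum_right)
  qed
  ultimately show "gradient_at p (\<lambda>x. \<Sum>i\<in>A. T i (F i \<beta> x)) (\<lambda>s. \<Sum>i\<in>A. T i (F i (add_mset s \<beta>) x)) x"
    by simp
next
  fix \<beta>
  have "\<forall>i\<in>A. \<exists>M\<ge>0. \<forall>k. \<forall>x\<in>U. norm ((lapF ^^ k) (F i) \<beta> x) \<le> M * fact (2 * k) * L ^ k"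
    using F by (auto simp: family_def)
  then obtain M where M: "\<And>i. i \<in> A \<Longrightarrow> M i \<ge> 0"
    "\<And>i k x. i \<in> A \<Longrightarrow> x \<in> U \<Longrightarrow> norm ((lapF ^^ k) (F i) \<beta> x) \<le> M i * fact (2 * k) * L ^ k" by metis
  have "\<forall>i\<in>A. \<exists>B\<ge>0. \<forall>y. norm (T i y) \<le> norm y * B"
    using T bounded_linear.nonneg_bounded linear_conv_bounded_linear by blast
  then obtain B where B: "\<And>i. i \<in> A \<Longrightarrow> B i \<ge> 0" "\<And>i y. i \<in> A \<Longrightarrow> norm (T i y) \<le> norm y * B i"
    by metis
  have "norm ((lapF ^^ k) (\<lambda>\<beta> x. \<Sum>i\<in>A. T i (F i \<beta> x)) \<beta> x) \<le> (\<Sum>i\<in>A. M i * B i) * fact (2 * k) * L ^ k"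
    if x: "x \<in> U" for k x
  proof -
    have "norm ((lapF ^^ k) (\<lambda>\<beta> x. \<Sum>i\<in>A. T i (F i \<beta> x)) \<beta> x) \<le> (\<Sum>i\<in>A. (M i * fact (2 * k) * L ^ k) * B i)"
      using M(2) B x by (simp add: lapF_power_lin[OF T]) (intro sum_norm_le order_trans[OF B(2)] mult_right_mono, auto)
    also have "\<dots> = (\<Sum>i\<in>A. M i * B i) * fact (2 * k) * L ^ k"
      by (simp add: sum_distrib_left sum_distrib_right mult_ac)
    finally show ?thesis .
  qed
  then show "\<exists>M\<ge>0. \<forall>k. \<forall>x\<in>U. norm ((lapF ^^ k) (\<lambda>\<beta> x. \<Sum>i\<in>A. T i (F i \<beta> x)) \<beta> x) \<le> M * fact (2 * k) * L ^ k"
    using M(1) B(1) by (intro exI[of _ "\<Sum>i\<in>A. M i * B i"]) (auto intro: sum_nonneg)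
qed

lemma proj_Mspace: "x \<in> Mspace v p \<Longrightarrow> proj x = x"
  unfolding Mspace_def
proof (induction x rule: span_induct_alt)
  case base
  then show ?case by (simp add: proj_def)
next
  case (step c x y)
  then show ?case using p_less_m by (auto simp: proj_v)
qed

lemma proj_in_Mspace: "proj x \<in> Mspace v p"
  unfolding proj_def Mspace_def by (intro span_sum span_scale span_base) auto

text \<open>The power series at \<open>a\<close> becomes a family by differentiating its monomials.
  Absolute convergence at the corner of a cube gives one majorant for all terms, and on the cube of
  half the size \<open>monomial_deriv_bound\<close> turns it into estimates for every
  derivative.\<close>

lemma analytic_family:
  assumes an: "real_analytic_on v p \<Omega>0 f0" and a: "a \<in> \<Omega>0" "a \<in> Mspace v p"
  obtains \<sigma> L F where "\<sigma> > 0" "L > 0" "family (cylinder a \<sigma>) L F"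
    "\<And>x. x \<in> cylinder a \<sigma> \<Longrightarrow> proj x \<in> \<Omega>0" "\<And>x. x \<in> cylinder a \<sigma> \<Longrightarrow> F {#} x = f0 (proj x)"
proof -
  define A where "A = {\<alpha>::nat \<Rightarrow> nat. \<forall>i. p < i \<longrightarrow> \<alpha> i = 0}"
  obtain \<epsilon> c where \<epsilon>: "\<epsilon> > 0" and c: "\<And>t. (\<Sum>s\<le>p. (t s)\<^sup>2) < \<epsilon>\<^sup>2 \<Longrightarrow>
      a + (\<Sum>s\<le>p. t s *\<^sub>R v s) \<in> \<Omega>0 \<and>
      ((\<lambda>\<alpha>. (\<Prod>s\<le>p. t s ^ \<alpha> s) *\<^sub>R c \<alpha>) has_sum f0 (a + (\<Sum>s\<le>p. t s *\<^sub>R v s))) A"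
    using an a unfolding real_analytic_on_def A_def by blast
  \<comment> \<open>Makes the cube of half-side \<rho> fit into the ball of radius \<epsilon>: (p +
    1) \<rho>^2 < (p + 2)^2 \<rho>^2 = \<epsilon>^2.\<close>
  define \<rho> where "\<rho> = \<epsilon> / real (p + 2)"
  have \<rho>: "\<rho> > 0" using \<epsilon> by (simp add: \<rho>_def)
  have small: "(\<Sum>s\<le>p. (t s)\<^sup>2) < \<epsilon>\<^sup>2" if t: "\<And>s. s \<le> p \<Longrightarrow> \<bar>t s\<bar> \<le> \<rho>" for t :: "nat \<Rightarrow> real"
  proof -
    have "(\<Sum>s\<le>p. (t s)\<^sup>2) \<le> (\<Sum>s\<le>p. \<rho>\<^sup>2)"
      using t by (intro sum_mono) (metis abs_le_square_iff abs_of_pos \<rho> atMost_iff)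
    also have "\<dots> = real (p + 1) * \<rho>\<^sup>2" by simp
    also have "\<dots> < (real (p + 2))\<^sup>2 * \<rho>\<^sup>2"
      using \<rho> by (intro mult_strict_right_mono) (auto simp: power2_eq_square algebra_simps intro: add_pos_nonneg)
    also have "\<dots> = \<epsilon>\<^sup>2"
      unfolding \<rho>_def by (simp add: power_divide del: of_nat_add)
    finally show ?thesis .
  qed
  \<comment> \<open>Termwise differentiation is applied to series over the naturals, so the
    multi-indices are enumerated; \<open>has_sum\<close> makes the order immaterial.\<close>
  define en where "en = from_nat_into A"
  have en: "bij_betw en UNIV A"
    unfolding en_def A_def by (intro bij_betw_from_nat_into countable_multi_indices infinite_multi_indices)
  define C where "C n = c (en n)" for n
  have ser: "(\<lambda>n. (\<Prod>s\<le>p. t s ^ en n s) *\<^sub>R C n) sums f0 (a + (\<Sum>s\<le>p. t s *\<^sub>R v s))"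
    if "\<And>s. s \<le> p \<Longrightarrow> \<bar>t s\<bar> \<le> \<rho>" for t :: "nat \<Rightarrow> real"
    using c[OF small[OF that]] unfolding C_def
    by (intro has_sum_imp_sums) (simp add: has_sum_reindex_bij_betw[OF en, where f = "\<lambda>\<alpha>. (\<Prod>s\<le>p. t s ^ \<alpha> s) *\<^sub>R c \<alpha>"])
  \<comment> \<open>Norms of the terms at the corner t = (\<rho>, ..., \<rho>).\<close>
  define b where "b n = (\<Prod>s\<le>p. \<rho> ^ en n s) * norm (C n)" for n
  have b0: "b n \<ge> 0" for n
    using \<rho> by (simp add: b_def prod_nonneg)
  have sb: "summable b"
  proof -
    have "(\<lambda>\<alpha>. (\<Prod>s\<le>p. \<rho> ^ \<alpha> s) *\<^sub>R c \<alpha>) summable_on A"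
      using c[OF small[of "\<lambda>_. \<rho>"]] \<rho> by (auto simp: summable_on_def)
    then have "(\<lambda>\<alpha>. norm ((\<Prod>s\<le>p. \<rho> ^ \<alpha> s) *\<^sub>R c \<alpha>)) summable_on A"
      by (rule summable_on_euclidean_imp_abs_summable_on)
    then have "(\<lambda>n. norm ((\<Prod>s\<le>p. \<rho> ^ en n s) *\<^sub>R c (en n))) summable_on UNIV"
      by (subst summable_on_reindex_bij_betw[OF en, where f = "\<lambda>\<alpha>. norm ((\<Prod>s\<le>p. \<rho> ^ \<alpha> s) *\<^sub>R c \<alpha>)"])
    then have "summable (\<lambda>n. norm ((\<Prod>s\<le>p. \<rho> ^ en n s) *\<^sub>R c (en n)))"
      by (rule summable_on_imp_summable)
    then show ?thesis
      using \<rho> by (simp add: b_def[abs_def] C_def prod_nonneg)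
  qed
  \<comment> \<open>Half of \<rho>, because \<open>monomial_deriv_bound\<close> doubles the
    radius.\<close>
  define \<sigma> where "\<sigma> = \<rho> / 2"
  \<comment> \<open>At least 1, as \<open>prod_fact_count_le\<close> demands.\<close>
  define K where "K = max 1 (1 / \<sigma>)"
  have \<sigma>: "\<sigma> > 0" using \<rho> by (simp add: \<sigma>_def)
  define T where "T \<beta> n x = (\<Prod>s\<le>p. monomial_deriv (en n s) (count \<beta> s) (\<xi> s (x - a))) *\<^sub>R C n" for \<beta> n x
  define F where "F \<beta> x = (\<Sum>n. T \<beta> n x)" for \<beta> x
  have T_bound: "norm (T \<beta> n x) \<le> (fact (size \<beta>) * K ^ size \<beta>) * b n" if x: "x \<in> cylinder a \<sigma>" for \<beta> n x
  proof -
    have "\<bar>\<Prod>s\<le>p. monomial_deriv (en n s) (count \<beta> s) (\<xi> s (x - a))\<bar> =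
        (\<Prod>s\<le>p. \<bar>monomial_deriv (en n s) (count \<beta> s) (\<xi> s (x - a))\<bar>)"
      by (rule abs_prod)
    also have "\<dots> \<le> (\<Prod>s\<le>p. \<rho> ^ en n s * (fact (count \<beta> s) * K ^ count \<beta> s))"
    proof (intro prod_mono conjI)
      fix s assume "s \<in> {..p}"
      then have "\<bar>monomial_deriv (en n s) (count \<beta> s) (\<xi> s (x - a))\<bar> \<le> (2 * \<sigma>) ^ en n s * (fact (count \<beta> s) * (1 / \<sigma>) ^ count \<beta> s)"
        using x \<sigma> by (intro monomial_deriv_bound) (auto simp: cylinder_def intro: less_imp_le)
      also have "\<dots> \<le> \<rho> ^ en n s * (fact (count \<beta> s) * K ^ count \<beta> s)"
        using \<rho> \<sigma> by (intro mult_mono power_mono) (auto simp: K_def \<sigma>_def)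
      finally show "\<bar>monomial_deriv (en n s) (count \<beta> s) (\<xi> s (x - a))\<bar> \<le> \<rho> ^ en n s * (fact (count \<beta> s) * K ^ count \<beta> s)" .
    qed auto
    also have "\<dots> = (\<Prod>s\<le>p. \<rho> ^ en n s) * (\<Prod>s\<le>p. fact (count \<beta> s) * K ^ count \<beta> s)"
      by (rule prod.distrib)
    also have "\<dots> \<le> (\<Prod>s\<le>p. \<rho> ^ en n s) * (fact (size \<beta>) * K ^ size \<beta>)"
      using \<rho> by (intro mult_left_mono prod_fact_count_le prod_nonneg) (auto simp: K_def)
    finally have "norm (T \<beta> n x) \<le> (\<Prod>s\<le>p. \<rho> ^ en n s) * (fact (size \<beta>) * K ^ size \<beta>) * norm (C n)"
      unfolding T_def by (simp add: mult_right_mono)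
    then show ?thesis by (simp add: b_def mult_ac)
  qed
  have T_summable: "summable (\<lambda>n. T \<beta> n x)" if "x \<in> cylinder a \<sigma>" for \<beta> x
    by (rule summable_comparison_test'[OF summable_mult[OF sb] T_bound[OF that]])
  have T_grad: "gradient_at p (T \<beta> n) (\<lambda>s. T (add_mset s \<beta>) n x) x" for \<beta> n x
  proof -
    let ?d = "\<lambda>s x. monomial_deriv (en n s) (count \<beta> s) (\<xi> s (x - a))"
    let ?d' = "\<lambda>s. monomial_deriv (en n s) (Suc (count \<beta> s)) (\<xi> s (x - a))"
    have "(?d s has_derivative (\<lambda>h. \<xi> s h * ?d' s)) (at x)" for s
      by (rule DERIV_compose_FDERIV[OF monomial_deriv_has_field_derivative])
        (rule has_derivative_eq_rhs, rule derivative_intros, auto intro!: derivative_eq_intros)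
    then have "((\<lambda>x. \<Prod>s\<le>p. ?d s x) has_derivative (\<lambda>h. \<Sum>i\<le>p. (\<xi> i h * ?d' i) * (\<Prod>j\<in>{..p} - {i}. ?d j x))) (at x)"
      by (rule has_derivative_prod)
    then have "(T \<beta> n has_derivative (\<lambda>h. (\<Sum>i\<le>p. (\<xi> i h * ?d' i) * (\<Prod>j\<in>{..p} - {i}. ?d j x)) *\<^sub>R C n)) (at x)"
      unfolding T_def[abs_def] by (rule has_derivative_scaleR_left)
    moreover have "?d' i * (\<Prod>j\<in>{..p} - {i}. ?d j x) =
        (\<Prod>j\<le>p. monomial_deriv (en n j) (count (add_mset i \<beta>) j) (\<xi> j (x - a)))" if "i \<le> p" for i
    proof -
      have "(\<Prod>j\<in>{..p} - {i}. ?d j x) = (\<Prod>j\<in>{..p} - {i}. monomial_deriv (en n j) (count (add_mset i \<beta>) j) (\<xi> j (x - a)))"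
        by (rule prod.cong) auto
      then show ?thesis using that by (subst (2) prod.remove[of _ i]) auto
    qed
    ultimately show ?thesis
      by (simp add: T_def scaleR_sum_left mult.assoc)
  qed
  have F_grad: "gradient_at p (F \<beta>) (\<lambda>s. F (add_mset s \<beta>) x) x" if x: "x \<in> cylinder a \<sigma>" for \<beta> x
    unfolding F_def[abs_def]
    by (rule has_derivative_suminf_gradient[where V = "cylinder a \<sigma>" and B = "\<lambda>n. (fact (Suc (size \<beta>)) * K ^ Suc (size \<beta>)) * b n"])
       (use T_bound[of _ "add_mset _ \<beta>"] in \<open>auto intro!: bounded_linear_\<xi> open_cylinder x T_grad summable_mult sb T_summable simp del: fact_Suc power_Suc\<close>)
  have "norm (F \<beta> x) \<le> (\<Sum>n. b n) * (fact (size \<beta>) * K ^ size \<beta>)" if x: "x \<in> cylinder a \<sigma>" for \<beta> x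
  proof -
    have "norm (F \<beta> x) \<le> (\<Sum>n. (fact (size \<beta>) * K ^ size \<beta>) * b n)"
      unfolding F_def by (rule norm_suminf_le[OF T_bound[OF x] summable_mult[OF sb]])
    then show ?thesis unfolding suminf_mult[OF sb] by (simp only: mult.commute)
  qed
  then have fam: "family (cylinder a \<sigma>) (real (p + 1) * (4 * K\<^sup>2)) F"
    by (intro familyI_bound F_grad) (auto simp: K_def intro: suminf_nonneg sb b0)
  have proj: "proj x = a + (\<Sum>s\<le>p. \<xi> s (x - a) *\<^sub>R v s)" for x
    using proj_Mspace[OF a(2)] proj_simps(2)[of x a] unfolding proj_def[of "x - a"] by (simp only:) simp
  have le: "\<bar>\<xi> s (x - a)\<bar> \<le> \<rho>" if "x \<in> cylinder a \<sigma>" "s \<le> p" for x s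
    using that \<rho> by (force simp: cylinder_def \<sigma>_def)
  show ?thesis
  proof (rule that[OF \<sigma> _ fam])
    show "real (p + 1) * (4 * K\<^sup>2) > 0"
      by (simp add: K_def)
    show "proj x \<in> \<Omega>0" if "x \<in> cylinder a \<sigma>" for x
      using c[OF small[of "\<lambda>s. \<xi> s (x - a)"]] le[OF that] by (auto simp: proj)
    show "F {#} x = f0 (proj x)" if "x \<in> cylinder a \<sigma>" for x
      using ser[of "\<lambda>s. \<xi> s (x - a)"] le[OF that] by (simp add: F_def T_def proj sums_iff del: \<xi>_simps)
  qed
qed

end

section \<open>Bessel-type series\<close>

definition bessel_coeff :: "nat \<Rightarrow> nat \<Rightarrow> real" where
  "bessel_coeff j k = 1 / (fact (2 * k) * (\<Prod>i<j. real (2 * k + 2 * i + 1)))"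

lemma bessel_coeff_nonneg: "bessel_coeff j k \<ge> 0"
  by (simp add: bessel_coeff_def prod_nonneg)

lemma bessel_coeff_le: "bessel_coeff j k \<le> 1 / fact (2 * k)"
proof -
  have "(\<Prod>i<j. real (2 * k + 2 * i + 1)) \<ge> 1"
    by (intro prod_ge_1) auto
  then show ?thesis
    unfolding bessel_coeff_def by (intro divide_left_mono mult_pos_pos) auto
qed

lemma bessel_coeff_Suc: "bessel_coeff j k = real (2 * k + 2 * j + 1) * bessel_coeff (Suc j) k"
  by (simp add: bessel_coeff_def)

text \<open>The factor 2k + 1 moves from the product into the factorial. Since the derivative of
  R^(k+1) in x_s is 2(k + 1) x_s R^k, this is the coefficient form of the rule for the derivative of
  S j in x_s.\<close>

lemma bessel_coeff_shift: "bessel_coeff (Suc j) k = real (2 * Suc k) * bessel_coeff j (Suc k)"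
proof -
  have "(\<Prod>i<Suc j. real (2 * k + 2 * i + 1)) = real (2 * k + 1) * (\<Prod>i<j. real (2 * Suc k + 2 * i + 1))"
    by (subst prod.lessThan_Suc_shift) (simp add: algebra_simps)
  moreover have "fact (2 * Suc k) = (real (2 * Suc k) * real (2 * k + 1)) * fact (2 * k)"
    by simp
  moreover have "1 / (f * (b * P)) = a * (1 / (a * b * f * P))" if "a \<noteq> 0" for a b f P :: real
    using that by simp
  ultimately show ?thesis
    unfolding bessel_coeff_def by (simp del: of_nat_Suc of_nat_mult of_nat_add fact_Suc mult_Suc_right)
qed

section \<open>Directional derivatives from gradients\<close>

lemma (in coordinate_frame) pd_of_gradient:
  assumes "gradient_at n f D x"
  shows "pd u f x = (\<Sum>i\<le>n. \<xi> i u *\<^sub>R D i)" "has_pd u f x"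
proof -
  have "((\<lambda>t. f (x + t *\<^sub>R u)) has_derivative (\<lambda>t. \<Sum>i\<le>n. \<xi> i (t *\<^sub>R u) *\<^sub>R D i)) (at 0)"
    by (rule has_derivative_compose[where g = f, of _ "\<lambda>t. t *\<^sub>R u"])
      (use assms in \<open>auto intro!: derivative_eq_intros\<close>)
  then have "((\<lambda>t. f (x + t *\<^sub>R u)) has_vector_derivative (\<Sum>i\<le>n. \<xi> i u *\<^sub>R D i)) (at 0)"
    by (simp add: has_vector_derivative_def scaleR_sum_right)
  then show "pd u f x = (\<Sum>i\<le>n. \<xi> i u *\<^sub>R D i)" "has_pd u f x"
    by (auto simp: pd_def has_pd_def vector_derivative_at intro: differentiableI_vector)
qed

text \<open>Agreement along one line suffices, and the two lines may start at different points. This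
  compares functions on R^(p+1) with their cylindrical extensions, and functions known on a
  relatively open set with functions on an open one.\<close>

lemma pd_cong:
  assumes "\<forall>\<^sub>F t in nhds 0. f (x + t *\<^sub>R u) = g (y + t *\<^sub>R u)"
  shows "pd u f x = pd u g y" "has_pd u f x \<longleftrightarrow> has_pd u g y"
proof -
  have *: "((\<lambda>t. f (x + t *\<^sub>R u)) has_vector_derivative d) (at 0) \<longleftrightarrow>
      ((\<lambda>t. g (y + t *\<^sub>R u)) has_vector_derivative d) (at 0)" for d
    using assms eventually_nhds_x_imp_x[OF assms]
    by (intro has_vector_derivative_cong_ev) (auto elim: eventually_mono)
  then show "pd u f x = pd u g y" by (simp add: pd_def vector_derivative_def)
  show "has_pd u f x \<longleftrightarrow> has_pd u g y"
    using * unfolding has_pd_def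
    by (meson differentiableI_vector vector_derivative_works)
qed

text \<open>The same abstraction as in \<open>CK_even\<close> and \<open>CK_odd\<close>, so that it
  can be folded there syntactically.\<close>

definition neg_lap :: "(nat \<Rightarrow> 'a::real_normed_vector) \<Rightarrow> nat \<Rightarrow> ('a \<Rightarrow> 'a) \<Rightarrow> 'a \<Rightarrow> 'a" where
  "neg_lap v p = (\<lambda>g y. - lap_p v p g y)"

section \<open>Functions controlled on common neighbourhoods\<close>

text \<open>Radius and rate are fixed once per centre. Every function derived from f0 is controlled
  with the same \<open>\<sigma> a\<close> and \<open>L a\<close>, so that one set \<open>V\<close>
  serves them all.\<close>

locale analytic_neighbourhoods = coordinate_frame +
  fixes \<Omega>0 :: "'a set" and \<sigma> L :: "'a \<Rightarrow> real"
  assumes \<sigma>_pos: "a \<in> \<Omega>0 \<Longrightarrow> \<sigma> a > 0" and L_pos: "a \<in> \<Omega>0 \<Longrightarrow> L a > 0"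
    and \<Omega>0_sub: "\<Omega>0 \<subseteq> Mspace v p"
    and proj_cylinder: "a \<in> \<Omega>0 \<Longrightarrow> x \<in> cylinder a (\<sigma> a) \<Longrightarrow> proj x \<in> \<Omega>0"
begin

text \<open>The bound 1/(2L) in place of 1/L leaves geometric decay with ratio 1/2, uniformly on
  each piece.\<close>

definition V :: "'a set" where
  "V = (\<Union>a\<in>\<Omega>0. cylinder a (\<sigma> a) \<inter> {x. rad2 x < 1 / (2 * L a)})"

text \<open>Ties a formal family to a function. Through \<open>proj\<close> and
  \<open>proj_cylinder\<close>, only values of \<open>g\<close> on \<open>\<Omega>0\<close> enter
  when the centre lies in \<open>\<Omega>0\<close>.\<close>

definition represents :: "'a \<Rightarrow> (nat multiset \<Rightarrow> 'a \<Rightarrow> 'a) \<Rightarrow> ('a \<Rightarrow> 'a) \<Rightarrow> bool" where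
  "represents a F g \<longleftrightarrow> family (cylinder a (\<sigma> a)) (L a) F \<and> (\<forall>x\<in>cylinder a (\<sigma> a). F {#} x = g (proj x))"

definition regular :: "('a \<Rightarrow> 'a) \<Rightarrow> bool" where
  "regular g \<longleftrightarrow> (\<forall>a\<in>\<Omega>0. \<exists>F. represents a F g)"

lemma in_own_cylinder: "a \<in> \<Omega>0 \<Longrightarrow> a \<in> cylinder a (\<sigma> a)"
  using \<sigma>_pos by (simp add: cylinder_def)

text \<open>For s \<le> p the line through \<open>x\<close> in direction \<open>v s\<close> projects
  to the line through \<open>proj x\<close> in the same direction, so the formal index
  \<open>s\<close> is realised by an actual derivative of \<open>g\<close>.\<close>

lemma represents_pd:
  assumes F: "represents a F g" and s: "s \<le> p"
  shows "represents a (\<lambda>\<beta>. F (add_mset s \<beta>)) (pd (v s) g)"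
proof -
  have "F {#s#} x = pd (v s) g (proj x)" if x: "x \<in> cylinder a (\<sigma> a)" for x
  proof -
    have "F {#s#} x = pd (v s) (F {#}) x"
    proof (subst pd_of_gradient(1)[where n = p])
      show "gradient_at p (F {#}) (\<lambda>s. F {#s#} x) x"
        using F x by (auto simp: represents_def family_def)
      have "(\<Sum>i\<le>p. \<xi> i (v s) *\<^sub>R F {#i#} x) = (\<Sum>i\<le>p. if i = s then F {#s#} x else 0)"
        using s p_less_m by (intro sum.cong) (auto simp: \<xi>_v)
      then show "F {#s#} x = (\<Sum>i\<le>p. \<xi> i (v s) *\<^sub>R F {#i#} x)" using s by simp
    qed
    also have "\<dots> = pd (v s) g (proj x)"
    proof (rule pd_cong(1))
      have "((\<lambda>t. x + t *\<^sub>R v s) \<longlongrightarrow> x + 0 *\<^sub>R v s) (nhds (0::real))"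
        by (intro tendsto_intros filterlim_ident)
      then have "\<forall>\<^sub>F t in nhds 0. x + t *\<^sub>R v s \<in> cylinder a (\<sigma> a)"
        using x open_cylinder by (intro topological_tendstoD) auto
      then show "\<forall>\<^sub>F t in nhds 0. F {#} (x + t *\<^sub>R v s) = g (proj x + t *\<^sub>R v s)"
        by eventually_elim (use F s p_less_m in \<open>auto simp: represents_def proj_v\<close>)
    qed
    finally show ?thesis .
  qed
  then show ?thesis
    using F by (auto simp: represents_def intro: family_shift)
qed

lemma represents_neg_lap:
  assumes "represents a F g"
  shows "represents a (lapF F) (neg_lap v p g)"
  using assms represents_pd[OF represents_pd[OF assms]]
  by (auto simp: represents_def family_lapF lapF_def lap_p_def neg_lap_def)

lemma represents_neg_lap_power:
  "represents a F g \<Longrightarrow> represents a ((lapF ^^ k) F) ((neg_lap v p ^^ k) g)"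
  by (induction k) (auto intro: represents_neg_lap)

lemma represents_lin:
  assumes "a \<in> \<Omega>0" "finite A" "\<And>i. i \<in> A \<Longrightarrow> represents a (F i) (g i)" "\<And>i. i \<in> A \<Longrightarrow> linear (T i)"
  shows "represents a (\<lambda>\<beta> x. \<Sum>i\<in>A. T i (F i \<beta> x)) (\<lambda>x. \<Sum>i\<in>A. T i (g i x))"
  using assms L_pos[of a] unfolding represents_def by (intro conjI family_lin) auto

lemma regular_pd: "regular g \<Longrightarrow> s \<le> p \<Longrightarrow> regular (pd (v s) g)"
  unfolding regular_def using represents_pd by blast

lemma regular_neg_lap: "regular g \<Longrightarrow> regular (neg_lap v p g)"
  unfolding regular_def using represents_neg_lap by blast

lemma regular_neg_lap_power: "regular g \<Longrightarrow> regular ((neg_lap v p ^^ k) g)"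
  unfolding regular_def using represents_neg_lap_power by blast

lemma regular_lin:
  assumes "finite A" "\<And>i. i \<in> A \<Longrightarrow> regular (g i)" "\<And>i. i \<in> A \<Longrightarrow> linear (T i)"
  shows "regular (\<lambda>x. \<Sum>i\<in>A. T i (g i x))"
  unfolding regular_def
proof
  fix a assume a: "a \<in> \<Omega>0"
  then have "\<forall>i\<in>A. \<exists>F. represents a F (g i)" using assms(2) by (auto simp: regular_def)
  then obtain F where "\<And>i. i \<in> A \<Longrightarrow> represents a (F i) (g i)" by metis
  then show "\<exists>F. represents a F (\<lambda>x. \<Sum>i\<in>A. T i (g i x))"
    using represents_lin a assms by blast
qed

text \<open>Both orders are the value of the representing family at the same multiset.\<close>

lemma pd_commute:
  assumes "regular g" "s \<le> p" "t \<le> p" "y \<in> \<Omega>0"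
  shows "pd (v s) (pd (v t) g) y = pd (v t) (pd (v s) g) y"
proof -
  obtain F where F: "represents y F g" using assms by (auto simp: regular_def)
  have y: "y \<in> cylinder y (\<sigma> y)" "proj y = y" using assms in_own_cylinder \<Omega>0_sub proj_Mspace by auto
  show ?thesis
    using represents_pd[OF represents_pd[OF F assms(2)] assms(3)] represents_pd[OF represents_pd[OF F assms(3)] assms(2)] y
    unfolding represents_def by (metis add_mset_commute)
qed

section \<open>Convergence, recurrence and gradient of the series\<close>

definition bessel_series :: "nat \<Rightarrow> ('a \<Rightarrow> 'a) \<Rightarrow> 'a \<Rightarrow> 'a" where
  "bessel_series j g x = (\<Sum>k. (bessel_coeff j k * rad2 x ^ k) *\<^sub>R (neg_lap v p ^^ k) g (proj x))"

lemma open_V: "open V"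
  unfolding V_def rad2_def
  by (intro open_UN ballI open_Int open_cylinder open_Collect_less continuous_intros)

text \<open>The growth (2k)! is absorbed by \<open>bessel_coeff\<close> and L^k by the radius; for
  every \<open>j\<close> the ratio 1/2 is left over.\<close>

lemma bessel_term_bound:
  assumes a: "a \<in> \<Omega>0" and r: "rad2 x < 1 / (2 * L a)"
    and n: "norm y \<le> M * fact (2 * k) * L a ^ k"
  shows "norm ((bessel_coeff j k * rad2 x ^ k) *\<^sub>R y) \<le> M * (1 / 2) ^ k"
proof -
  have "norm ((bessel_coeff j k * rad2 x ^ k) *\<^sub>R y) = bessel_coeff j k * rad2 x ^ k * norm y"
    using bessel_coeff_nonneg rad2_nonneg by (simp add: abs_mult)
  also have "\<dots> \<le> (1 / fact (2 * k)) * (1 / (2 * L a)) ^ k * (M * fact (2 * k) * L a ^ k)"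
    using r n rad2_nonneg[of x] L_pos[OF a] bessel_coeff_le bessel_coeff_nonneg by (intro mult_mono power_mono) auto
  also have "\<dots> = M * (1 / 2) ^ k"
    using L_pos[OF a] by (simp add: power_divide power_mult_distrib)
  finally show ?thesis .
qed

lemma family_sum_summable:
  assumes a: "a \<in> \<Omega>0" and x: "x \<in> cylinder a (\<sigma> a)" "rad2 x < 1 / (2 * L a)" and F: "family (cylinder a (\<sigma> a)) (L a) F"
  shows "summable (\<lambda>k. (bessel_coeff j k * rad2 x ^ k) *\<^sub>R (lapF ^^ k) F \<beta> x)"
proof -
  obtain M where "\<And>k. norm ((lapF ^^ k) F \<beta> x) \<le> M * fact (2 * k) * L a ^ k"
    using F x unfolding family_def by blast
  then have "norm ((bessel_coeff j k * rad2 x ^ k) *\<^sub>R (lapF ^^ k) F \<beta> x) \<le> M * (1 / 2) ^ k" for k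
    using bessel_term_bound[OF a x(2)] by blast
  then show ?thesis
    by (rule summable_comparison_test'[where N = 0 and g = "\<lambda>k. M * (1 / 2) ^ k", rotated])
      (intro summable_mult summable_geometric, simp)
qed

lemma represents_power_eq:
  "represents a F g \<Longrightarrow> x \<in> cylinder a (\<sigma> a) \<Longrightarrow> (neg_lap v p ^^ k) g (proj x) = (lapF ^^ k) F {#} x"
  using represents_neg_lap_power[of a F g k] by (auto simp: represents_def)

lemma bessel_series_represents:
  assumes "represents a F g" "x \<in> cylinder a (\<sigma> a)"
  shows "bessel_series j g x = (\<Sum>k. (bessel_coeff j k * rad2 x ^ k) *\<^sub>R (lapF ^^ k) F {#} x)"
  using represents_power_eq[OF assms] by (simp add: bessel_series_def)

lemma bessel_series_summable:
  assumes "regular g" "x \<in> V"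
  shows "summable (\<lambda>k. (bessel_coeff j k * rad2 x ^ k) *\<^sub>R (neg_lap v p ^^ k) g (proj x))"
proof -
  obtain a where a: "a \<in> \<Omega>0" "x \<in> cylinder a (\<sigma> a)" "rad2 x < 1 / (2 * L a)"
    using assms by (auto simp: V_def)
  obtain F where F: "represents a F g" using assms a by (auto simp: regular_def)
  show ?thesis
    using family_sum_summable[OF a, of F] F represents_power_eq[OF F a(2)] by (simp add: represents_def)
qed

text \<open>Lets the Dirac operator and the Laplacian, finite sums of constant linear maps applied
  to derivatives, be moved out of the series.\<close>

lemma bessel_series_lin:
  assumes A: "finite A" and g: "\<And>i. i \<in> A \<Longrightarrow> regular (g i)" and T: "\<And>i. i \<in> A \<Longrightarrow> linear (T i)" and x: "x \<in> V"
  shows "bessel_series j (\<lambda>x. \<Sum>i\<in>A. T i (g i x)) x = (\<Sum>i\<in>A. T i (bessel_series j (g i) x))"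
proof -
  obtain a where a: "a \<in> \<Omega>0" "x \<in> cylinder a (\<sigma> a)" "rad2 x < 1 / (2 * L a)"
    using x by (auto simp: V_def)
  then have "\<forall>i\<in>A. \<exists>F. represents a F (g i)" using g by (auto simp: regular_def)
  then obtain F where F: "\<And>i. i \<in> A \<Longrightarrow> represents a (F i) (g i)" by metis
  have bl: "bounded_linear (T i)" if "i \<in> A" for i
    using T[OF that] linear_conv_bounded_linear by blast
  have sm: "summable (\<lambda>k. (bessel_coeff j k * rad2 x ^ k) *\<^sub>R (lapF ^^ k) (F i) {#} x)" if "i \<in> A" for i
    using family_sum_summable[OF a] F[OF that] by (simp add: represents_def)
  have rep: "represents a (\<lambda>\<beta> x. \<Sum>i\<in>A. T i (F i \<beta> x)) (\<lambda>x. \<Sum>i\<in>A. T i (g i x))"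
    using a(1) A F T by (rule represents_lin)
  have "bessel_series j (\<lambda>x. \<Sum>i\<in>A. T i (g i x)) x = (\<Sum>k. \<Sum>i\<in>A. T i ((bessel_coeff j k * rad2 x ^ k) *\<^sub>R (lapF ^^ k) (F i) {#} x))"
    unfolding bessel_series_represents[OF rep a(2)]
    by (simp add: lapF_power_lin[OF T] scaleR_sum_right linear_cmul[OF T])
  also have "\<dots> = (\<Sum>i\<in>A. \<Sum>k. T i ((bessel_coeff j k * rad2 x ^ k) *\<^sub>R (lapF ^^ k) (F i) {#} x))"
    by (intro suminf_sum bounded_linear.summable[OF bl] sm)
  also have "\<dots> = (\<Sum>i\<in>A. T i (bessel_series j (g i) x))"
    by (intro sum.cong refl) (simp add: bounded_linear.suminf[OF bl sm] bessel_series_represents[OF F a(2)])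
  finally show ?thesis .
qed

text \<open>The three-term recurrence of Bessel functions. Multiplication by R shifts k by one, and
  coefficientwise w (j+2) k = w j (k+1) - (2j+1) w (j+1) (k+1).\<close>

lemma bessel_series_recurrence:
  assumes g: "regular g" and x: "x \<in> V"
  shows "rad2 x *\<^sub>R bessel_series (Suc (Suc j)) (neg_lap v p g) x = bessel_series j g x - real (2 * j + 1) *\<^sub>R bessel_series (Suc j) g x"
proof -
  let ?G = "\<lambda>k. (neg_lap v p ^^ k) g (proj x)"
  let ?t = "\<lambda>j k. (bessel_coeff j k * rad2 x ^ k) *\<^sub>R ?G k"
  have 1: "rad2 x *\<^sub>R ((bessel_coeff (Suc (Suc j)) k * rad2 x ^ k) *\<^sub>R (neg_lap v p ^^ k) (neg_lap v p g) (proj x)) =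
      ?t j (Suc k) - real (2 * j + 1) *\<^sub>R ?t (Suc j) (Suc k)" for k
  proof -
    have c: "bessel_coeff (Suc (Suc j)) k = bessel_coeff j (Suc k) - real (2 * j + 1) * bessel_coeff (Suc j) (Suc k)"
      using bessel_coeff_shift[of "Suc j" k] bessel_coeff_Suc[of j "Suc k"] by (simp add: algebra_simps)
    have G: "(neg_lap v p ^^ k) (neg_lap v p g) = (neg_lap v p ^^ Suc k) g"
      by (simp only: funpow_Suc_right o_def)
    show ?thesis
      unfolding c G by (simp add: algebra_simps del: funpow.simps)
  qed
  \<comment> \<open>The term of index 0 is zero, so the shifted series on the right equals the full
    one.\<close>
  have z: "?t j 0 - real (2 * j + 1) *\<^sub>R ?t (Suc j) 0 = 0"
    using bessel_coeff_Suc[of j 0] by (simp add: algebra_simps)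
  have s: "summable (\<lambda>k. ?t j k)" for j using bessel_series_summable[OF g x] .
  have d: "summable (\<lambda>k. ?t j k - real (2 * j + 1) *\<^sub>R ?t (Suc j) k)"
    by (intro summable_diff summable_scaleR_right s)
  have "rad2 x *\<^sub>R bessel_series (Suc (Suc j)) (neg_lap v p g) x = (\<Sum>k. ?t j (Suc k) - real (2 * j + 1) *\<^sub>R ?t (Suc j) (Suc k))"
    unfolding bessel_series_def
    by (subst suminf_scaleR_right[OF bessel_series_summable[OF regular_neg_lap[OF g] x]]) (simp only: 1)
  also have "\<dots> = (\<Sum>k. ?t j k - real (2 * j + 1) *\<^sub>R ?t (Suc j) k)"
    by (subst suminf_split_head[OF d]) (simp only: z diff_zero)
  also have "\<dots> = bessel_series j g x - real (2 * j + 1) *\<^sub>R bessel_series (Suc j) g x"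
    unfolding bessel_series_def by (subst suminf_diff[symmetric, OF s summable_scaleR_right[OF s]]) (simp only: suminf_scaleR_right[OF s])
  finally show ?thesis .
qed

lemma sum_split_p: "(\<Sum>i\<le>m. f i) = (\<Sum>i\<le>p. f i) + (\<Sum>i\<in>{p+1..m}. f i)"
proof -
  have "{..m} = {..p} \<union> {p+1..m}" using p_less_m by auto
  then show ?thesis by (simp add: sum.union_disjoint)
qed

lemma rad2_derivative: "(rad2 has_derivative (\<lambda>h. \<Sum>s\<in>{p+1..m}. 2 * \<xi> s x * \<xi> s h)) (at x)"
  unfolding rad2_def[abs_def] by (auto intro!: derivative_eq_intros simp: mult_ac)

text \<open>Directions up to \<open>p\<close> differentiate only the iterates of g. Directions
  beyond differentiate only R^k, where \<open>bessel_coeff_shift\<close> produces the series of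
  index j + 1 for -\<Delta>_p g.\<close>

lemma gradient_bessel_series:
  assumes g: "regular g" and x: "x \<in> V"
  shows "gradient_at m (bessel_series j g) (\<lambda>i. if i \<le> p then bessel_series j (pd (v i) g) x else \<xi> i x *\<^sub>R bessel_series (Suc j) (neg_lap v p g) x) x"
proof -
  obtain a where a: "a \<in> \<Omega>0" "x \<in> cylinder a (\<sigma> a)" "rad2 x < 1 / (2 * L a)"
    using x by (auto simp: V_def)
  obtain F where F: "represents a F g" using g a by (auto simp: regular_def)
  define U where "U = cylinder a (\<sigma> a) \<inter> {x. rad2 x < 1 / (2 * L a)}"
  define T where "T k y = (bessel_coeff j k * rad2 y ^ k) *\<^sub>R (lapF ^^ k) F {#} y" for k y
  define W where "W k y = (bessel_coeff (Suc j) k * rad2 y ^ k) *\<^sub>R (lapF ^^ k) (lapF F) {#} y" for k y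
  \<comment> \<open>For i > p the derivative of the term of index k is a term of index k - 1 of the
    new series; the term of index 0 does not depend on these coordinates.\<close>
  define D where "D i k y = (if i \<le> p then (bessel_coeff j k * rad2 y ^ k) *\<^sub>R (lapF ^^ k) F {#i#} y
      else case k of 0 \<Rightarrow> 0 | Suc k' \<Rightarrow> \<xi> i y *\<^sub>R W k' y)" for i k y
  have fam: "family (cylinder a (\<sigma> a)) (L a) F" using F by (simp add: represents_def)
  have oU: "open U"
    unfolding U_def rad2_def by (intro open_Int open_cylinder open_Collect_less continuous_intros)
  have xU: "x \<in> U" using a by (simp add: U_def)
  have T_grad: "gradient_at m (T k) (\<lambda>i. D i k y) y" if y: "y \<in> U" for k y
  proof -
    have "gradient_at p ((lapF ^^ k) F {#}) (\<lambda>s. (lapF ^^ k) F {#s#} y) y"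
      using family_lapF_power[OF fam, of k] y by (auto simp: family_def U_def)
    then have *: "(T k has_derivative (\<lambda>h. (bessel_coeff j k * rad2 y ^ k) *\<^sub>R (\<Sum>i\<le>p. \<xi> i h *\<^sub>R (lapF ^^ k) F {#i#} y) +
       (bessel_coeff j k * (of_nat k * (\<Sum>s\<in>{p+1..m}. 2 * \<xi> s y * \<xi> s h) * rad2 y ^ (k - 1))) *\<^sub>R (lapF ^^ k) F {#} y)) (at y)"
      unfolding T_def[abs_def]
      by (intro has_derivative_scaleR has_derivative_mult_right has_derivative_power rad2_derivative)
    have "(bessel_coeff j k * (of_nat k * (\<Sum>s\<in>{p+1..m}. 2 * \<xi> s y * \<xi> s h) * rad2 y ^ (k - 1))) *\<^sub>R (lapF ^^ k) F {#} y =
        (\<Sum>i\<in>{p+1..m}. \<xi> i h *\<^sub>R D i k y)" for h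
    proof (cases k)
      case (Suc k')
      have "bessel_coeff j (Suc k') * (of_nat (Suc k') * (\<Sum>s\<in>{p+1..m}. 2 * \<xi> s y * \<xi> s h) * rad2 y ^ k') =
          (\<Sum>s\<in>{p+1..m}. \<xi> s h * (\<xi> s y * (bessel_coeff (Suc j) k' * rad2 y ^ k')))"
        unfolding bessel_coeff_shift sum_distrib_left sum_distrib_right
        by (intro sum.cong refl) (simp add: algebra_simps)
      then show ?thesis
        using Suc by (simp add: D_def W_def funpow_Suc_right scaleR_sum_left del: funpow.simps of_nat_Suc)
    qed (simp add: D_def)
    moreover have "(bessel_coeff j k * rad2 y ^ k) *\<^sub>R (\<Sum>i\<le>p. \<xi> i h *\<^sub>R (lapF ^^ k) F {#i#} y) =
        (\<Sum>i\<le>p. \<xi> i h *\<^sub>R D i k y)" for h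
      by (simp add: D_def scaleR_sum_right mult_ac)
    ultimately show ?thesis
      using * by (simp add: sum_split_p)
  qed
  have "\<forall>i. \<exists>M\<ge>0. \<forall>k. \<forall>x\<in>U. norm ((lapF ^^ k) F {#i#} x) \<le> M * fact (2 * k) * L a ^ k"
    using fam unfolding family_def U_def by blast
  then obtain M where M0: "\<And>i. M i \<ge> 0"
    and M: "\<And>i k x. x \<in> U \<Longrightarrow> norm ((lapF ^^ k) F {#i#} x) \<le> M i * fact (2 * k) * L a ^ k" by metis
  obtain N where N0: "N \<ge> 0"
    and N: "\<And>k x. x \<in> U \<Longrightarrow> norm ((lapF ^^ k) (lapF F) {#} x) \<le> N * fact (2 * k) * L a ^ k"
    using family_lapF[OF fam] unfolding family_def U_def by blast
  \<comment> \<open>For i > p this bounds |x_i| on \<open>U\<close>, by |x_i| \<le> 1 + x_i^2 \<le>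
    1 + R.\<close>
  define Q where "Q = 1 + 1 / (2 * L a)"
  have Q: "Q \<ge> 0" using L_pos[OF a(1)] by (simp add: Q_def)
  \<comment> \<open>One majorant for all directions; the factor 2 pays for the index shift when i >
    p.\<close>
  define B where "B k = ((\<Sum>i\<le>p. M i) + Q * N * 2) * (1 / 2) ^ k" for k :: nat
  have D_bound: "norm (D i k y) \<le> B k" if i: "i \<in> {..m}" and y: "y \<in> U" for i k y
  proof (cases "i \<le> p")
    case True
    then have "norm (D i k y) \<le> M i * (1 / 2) ^ k"
      using y by (simp only: D_def if_True) (intro bessel_term_bound[OF a(1) _ M], auto simp: U_def)
    also have "\<dots> \<le> B k"
      using True M0 N0 Q member_le_sum[of i "{..p}" M] unfolding B_def
      by (intro mult_right_mono) (auto intro: add_increasing2)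
    finally show ?thesis .
  next
    case False
    have "(\<Sum>i\<le>p. M i) \<ge> 0" using M0 by (simp add: sum_nonneg)
    then have B0: "B k \<ge> 0" "B (Suc k') \<ge> Q * (N * (1 / 2) ^ k')" for k'
      using N0 Q by (auto simp: B_def algebra_simps)
    have "(\<xi> i y)\<^sup>2 \<le> rad2 y"
      unfolding rad2_def using i False by (intro member_le_sum) auto
    moreover have "\<bar>\<xi> i y\<bar> \<le> 1 + (\<xi> i y)\<^sup>2"
      using sum_squares_ge_zero[of "\<bar>\<xi> i y\<bar> - 1" 0] by (simp add: power2_eq_square algebra_simps abs_if split: if_splits)
    ultimately have \<xi>Q: "\<bar>\<xi> i y\<bar> \<le> Q"
      using y by (simp add: Q_def U_def)
    show ?thesis
    proof (cases k)
      case 0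
      then show ?thesis using False B0 by (simp add: D_def)
    next
      case (Suc k')
      have "norm (W k' y) \<le> N * (1 / 2) ^ k'"
        unfolding W_def using y by (intro bessel_term_bound[OF a(1) _ N]) (auto simp: U_def)
      then have "norm (D i k y) \<le> Q * (N * (1 / 2) ^ k')"
        using Suc False \<xi>Q Q by (auto simp: D_def intro!: mult_mono)
      then show ?thesis using B0(2)[of k'] unfolding Suc by (rule order_trans)
    qed
  qed
  have "((\<lambda>x. \<Sum>k. T k x) has_derivative (\<lambda>h. \<Sum>i\<le>m. \<xi> i h *\<^sub>R (\<Sum>k. D i k x))) (at x)"
  proof (rule has_derivative_suminf_gradient[where V = U and B = B])
    show "summable B" unfolding B_def by (intro summable_mult summable_geometric) simp
    show "summable (\<lambda>k. T k y)" if "y \<in> U" for y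
      unfolding T_def using that by (intro family_sum_summable[OF a(1) _ _ fam]) (auto simp: U_def)
  qed (use oU xU T_grad D_bound bounded_linear_\<xi> in auto)
  moreover have "(\<Sum>k. D i k x) = (if i \<le> p then bessel_series j (pd (v i) g) x else \<xi> i x *\<^sub>R bessel_series (Suc j) (neg_lap v p g) x)" for i
  proof (cases "i \<le> p")
    case True
    then show ?thesis
      by (simp add: D_def bessel_series_represents[OF represents_pd[OF F True] a(2)] lapF_power_shift)
  next
    case False
    have W: "summable (\<lambda>k. W k x)"
      unfolding W_def by (rule family_sum_summable[OF a family_lapF[OF fam]])
    then have "(\<lambda>k. D i (Suc k) x) sums (\<xi> i x *\<^sub>R (\<Sum>k. W k x))"
      using False by (simp add: D_def summable_sums sums_scaleR_right)
    then have "(\<lambda>k. D i k x) sums (\<xi> i x *\<^sub>R (\<Sum>k. W k x))"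
      using False by (subst (asm) sums_Suc_iff) (simp add: D_def)
    then show ?thesis
      using False by (simp add: sums_iff bessel_series_represents[OF represents_neg_lap[OF F] a(2)] W_def)
  qed
  ultimately have "((\<lambda>x. \<Sum>k. T k x) has_derivative (\<lambda>h. \<Sum>i\<le>m. \<xi> i h *\<^sub>R
      (if i \<le> p then bessel_series j (pd (v i) g) x else \<xi> i x *\<^sub>R bessel_series (Suc j) (neg_lap v p g) x))) (at x)"
    by simp
  then show ?thesis
    \<comment> \<open>The family belongs to the centre \<open>a\<close>; the two series are
      identified on its piece \<open>U\<close>, which is enough for a derivative at
      \<open>x\<close>.\<close>
    by (rule has_derivative_transform_within_open[OF _ oU xU])
       (use bessel_series_represents[OF F] in \<open>auto simp: T_def U_def\<close>)
qed

section \<open>Second-order calculus on \<open>V\<close>\<close>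

lemma continuous_on_gradient:
  assumes "\<And>x. x \<in> V \<Longrightarrow> gradient_at m f (\<lambda>i. D i x) x"
  shows "continuous_on V f"
  using assms has_derivative_continuous continuous_at_imp_continuous_on by blast

lemma continuous_on_bessel_series: "regular g \<Longrightarrow> continuous_on V (bessel_series j g)"
  using gradient_bessel_series by (rule continuous_on_gradient)

lemma gradient_coord_scaleR:
  assumes "gradient_at m f D x" "s \<le> m"
  shows "gradient_at m (\<lambda>x. \<xi> s x *\<^sub>R f x) (\<lambda>i. (if i = s then f x else 0) + \<xi> s x *\<^sub>R D i) x"
proof -
  have "((\<lambda>x. \<xi> s x *\<^sub>R f x) has_derivative (\<lambda>h. \<xi> s x *\<^sub>R (\<Sum>i\<le>m. \<xi> i h *\<^sub>R D i) + \<xi> s h *\<^sub>R f x)) (at x)"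
    using assms by (intro has_derivative_scaleR bounded_linear_imp_has_derivative bounded_linear_\<xi>)
  moreover have "(\<Sum>i\<le>m. \<xi> i h *\<^sub>R ((if i = s then f x else 0) + \<xi> s x *\<^sub>R D i)) =
      \<xi> s x *\<^sub>R (\<Sum>i\<le>m. \<xi> i h *\<^sub>R D i) + \<xi> s h *\<^sub>R f x" for h
  proof -
    have "(\<Sum>i\<le>m. \<xi> i h *\<^sub>R (if i = s then f x else 0)) = (\<Sum>i\<le>m. if i = s then \<xi> s h *\<^sub>R f x else 0)"
      by (intro sum.cong) auto
    then show ?thesis
      using assms(2) by (simp add: scaleR_add_right sum.distrib scaleR_sum_right mult.commute)
  qed
  ultimately show ?thesis by simp
qed

lemma gradient_add:
  "gradient_at m f D x \<Longrightarrow> gradient_at m f' D' x \<Longrightarrow> gradient_at m (\<lambda>x. f x + f' x) (\<lambda>i. D i + D' i) x"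
  by (drule (1) has_derivative_add) (simp add: scaleR_add_right sum.distrib)

lemma gradient_linear:
  fixes f T :: "'a \<Rightarrow> 'a"
  assumes "gradient_at m f D x" "linear T"
  shows "gradient_at m (\<lambda>x. T (f x)) (\<lambda>i. T (D i)) x"
  using bounded_linear.has_derivative[OF linear_conv_bounded_linear[THEN iffD1, OF assms(2)] assms(1)]
  by (simp add: linear_sum[OF assms(2)] linear_cmul[OF assms(2)])

text \<open>\<open>l\<close> is the Laplacian of \<open>f\<close>; the gradient \<open>D\<close> is kept because the product rule for the Laplacian needs it.\<close>

definition C2 :: "('a \<Rightarrow> 'a) \<Rightarrow> (nat \<Rightarrow> 'a \<Rightarrow> 'a) \<Rightarrow> ('a \<Rightarrow> 'a) \<Rightarrow> bool" where
  "C2 f D l \<longleftrightarrow> (\<forall>x\<in>V. gradient_at m f (\<lambda>i. D i x) x) \<and>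
     (\<exists>E. (\<forall>i\<le>m. \<forall>x\<in>V. gradient_at m (D i) (\<lambda>t. E i t x) x) \<and>
          (\<forall>i\<le>m. \<forall>t\<le>m. continuous_on V (E i t)) \<and> (\<forall>x\<in>V. l x = (\<Sum>i\<le>m. E i i x)))"

lemma C2I:
  assumes "\<And>x. x \<in> V \<Longrightarrow> gradient_at m f (\<lambda>i. D i x) x"
    and "\<And>i x. i \<le> m \<Longrightarrow> x \<in> V \<Longrightarrow> gradient_at m (D i) (\<lambda>t. E i t x) x"
    and "\<And>i t. i \<le> m \<Longrightarrow> t \<le> m \<Longrightarrow> continuous_on V (E i t)"
    and "\<And>x. x \<in> V \<Longrightarrow> l x = (\<Sum>i\<le>m. E i i x)"
  shows "C2 f D l"
  unfolding C2_def by (intro conjI exI[of _ E] ballI allI impI assms)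

lemma C2E:
  assumes "C2 f D l"
  obtains E where "\<And>x. x \<in> V \<Longrightarrow> gradient_at m f (\<lambda>i. D i x) x"
    "\<And>i x. i \<le> m \<Longrightarrow> x \<in> V \<Longrightarrow> gradient_at m (D i) (\<lambda>t. E i t x) x"
    "\<And>i t. i \<le> m \<Longrightarrow> t \<le> m \<Longrightarrow> continuous_on V (E i t)"
    "\<And>x. x \<in> V \<Longrightarrow> l x = (\<Sum>i\<le>m. E i i x)"
proof -
  have 1: "\<forall>x\<in>V. gradient_at m f (\<lambda>i. D i x) x"
    using assms unfolding C2_def by (rule conjunct1)
  have "\<exists>E. (\<forall>i\<le>m. \<forall>x\<in>V. gradient_at m (D i) (\<lambda>t. E i t x) x) \<and>
      (\<forall>i\<le>m. \<forall>t\<le>m. continuous_on V (E i t)) \<and> (\<forall>x\<in>V. l x = (\<Sum>i\<le>m. E i i x))"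
    using assms unfolding C2_def by (rule conjunct2)
  then obtain E where E: "(\<forall>i\<le>m. \<forall>x\<in>V. gradient_at m (D i) (\<lambda>t. E i t x) x) \<and>
      (\<forall>i\<le>m. \<forall>t\<le>m. continuous_on V (E i t)) \<and> (\<forall>x\<in>V. l x = (\<Sum>i\<le>m. E i i x))" ..
  show ?thesis
    by (rule that[OF 1[rule_format] E[THEN conjunct1, rule_format] E[THEN conjunct2, THEN conjunct1, rule_format]
          E[THEN conjunct2, THEN conjunct2, rule_format]])
qed

lemma C2_linear:
  assumes "C2 f D l" and T: "linear T"
  shows "C2 (\<lambda>x. T (f x)) (\<lambda>i x. T (D i x)) (\<lambda>x. T (l x))"
  using assms(1)
proof (rule C2E)
  fix E
  assume E: "\<And>x. x \<in> V \<Longrightarrow> gradient_at m f (\<lambda>i. D i x) x"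
    "\<And>i x. i \<le> m \<Longrightarrow> x \<in> V \<Longrightarrow> gradient_at m (D i) (\<lambda>t. E i t x) x"
    "\<And>i t. i \<le> m \<Longrightarrow> t \<le> m \<Longrightarrow> continuous_on V (E i t)"
    "\<And>x. x \<in> V \<Longrightarrow> l x = (\<Sum>i\<le>m. E i i x)"
  show ?thesis
  proof (rule C2I[where E = "\<lambda>i t x. T (E i t x)"])
    show "continuous_on V (\<lambda>x. T (E i t x))" if "i \<le> m" "t \<le> m" for i t
      using E(3)[OF that] T by (rule linear_continuous_on_compose)
    show "T (l x) = (\<Sum>i\<le>m. T (E i i x))" if "x \<in> V" for x
      using E(4)[OF that] by (simp add: linear_sum[OF T])
  qed (use gradient_linear[OF E(1) T] gradient_linear[OF E(2) T] in blast)+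
qed

lemma C2_add:
  assumes "C2 f D l" "C2 f' D' l'"
  shows "C2 (\<lambda>x. f x + f' x) (\<lambda>i x. D i x + D' i x) (\<lambda>x. l x + l' x)"
  using assms(1)
proof (rule C2E)
  fix E
  assume E: "\<And>x. x \<in> V \<Longrightarrow> gradient_at m f (\<lambda>i. D i x) x"
    "\<And>i x. i \<le> m \<Longrightarrow> x \<in> V \<Longrightarrow> gradient_at m (D i) (\<lambda>t. E i t x) x"
    "\<And>i t. i \<le> m \<Longrightarrow> t \<le> m \<Longrightarrow> continuous_on V (E i t)"
    "\<And>x. x \<in> V \<Longrightarrow> l x = (\<Sum>i\<le>m. E i i x)"
  show ?thesis
    using assms(2)
  proof (rule C2E)
    fix E'
    assume E': "\<And>x. x \<in> V \<Longrightarrow> gradient_at m f' (\<lambda>i. D' i x) x"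
      "\<And>i x. i \<le> m \<Longrightarrow> x \<in> V \<Longrightarrow> gradient_at m (D' i) (\<lambda>t. E' i t x) x"
      "\<And>i t. i \<le> m \<Longrightarrow> t \<le> m \<Longrightarrow> continuous_on V (E' i t)"
      "\<And>x. x \<in> V \<Longrightarrow> l' x = (\<Sum>i\<le>m. E' i i x)"
    show ?thesis
      by (rule C2I[where E = "\<lambda>i t x. E i t x + E' i t x"])
         (simp_all add: E E' gradient_add continuous_on_add sum.distrib)
  qed
qed

lemma C2_sum:
  assumes "finite A" "\<And>s. s \<in> A \<Longrightarrow> \<exists>D. C2 (f s) D (l s)"
  shows "\<exists>D. C2 (\<lambda>x. \<Sum>s\<in>A. f s x) D (\<lambda>x. \<Sum>s\<in>A. l s x)"
  using assms
proof (induction A rule: finite_induct)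
  case empty
  have "C2 (\<lambda>_. 0) (\<lambda>_ _. 0) (\<lambda>_. 0)"
    by (rule C2I[where E = "\<lambda>_ _ _. 0"]) auto
  then show ?case by auto
next
  case (insert s A)
  obtain D D' where "C2 (f s) D (l s)" "C2 (\<lambda>x. \<Sum>s\<in>A. f s x) D' (\<lambda>x. \<Sum>s\<in>A. l s x)"
    using insert by blast
  from C2_add[OF this] show ?case using insert.hyps by (auto simp del: split_paired_Ex)
qed

lemma C2_coord_scaleR:
  assumes "C2 f D l" "s \<le> m"
  shows "C2 (\<lambda>x. \<xi> s x *\<^sub>R f x) (\<lambda>i x. (if i = s then f x else 0) + \<xi> s x *\<^sub>R D i x) (\<lambda>x. \<xi> s x *\<^sub>R l x + 2 *\<^sub>R D s x)"
  using assms(1)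
proof (rule C2E)
  fix E
  assume D: "\<And>x. x \<in> V \<Longrightarrow> gradient_at m f (\<lambda>i. D i x) x"
    and E: "\<And>i x. i \<le> m \<Longrightarrow> x \<in> V \<Longrightarrow> gradient_at m (D i) (\<lambda>t. E i t x) x"
    "\<And>i t. i \<le> m \<Longrightarrow> t \<le> m \<Longrightarrow> continuous_on V (E i t)"
    "\<And>x. x \<in> V \<Longrightarrow> l x = (\<Sum>i\<le>m. E i i x)"
  \<comment> \<open>Second partials of x_s f by the Leibniz rule. On the diagonal both conditional
    terms are active at i = s and give the 2 \<partial>_s f.\<close>
  define E' where "E' i t x = (if i = s then D t x else 0) + ((if t = s then D i x else 0) + \<xi> s x *\<^sub>R E i t x)" for i t x
  have cD: "continuous_on V (D i)" if "i \<le> m" for i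
    using E(1)[OF that] by (rule continuous_on_gradient)
  have "gradient_at m (\<lambda>x. (if i = s then f x else 0) + \<xi> s x *\<^sub>R D i x) (\<lambda>t. E' i t x) x" if "i \<le> m" "x \<in> V" for i x
  proof -
    have "gradient_at m (\<lambda>x. if i = s then f x else 0) (\<lambda>t. if i = s then D t x else 0) x"
      using D that by (cases "i = s") auto
    then show ?thesis
      unfolding E'_def using that E(1) assms(2)
      by (intro gradient_add gradient_coord_scaleR) auto
  qed
  moreover have "continuous_on V (E' i t)" if "i \<le> m" "t \<le> m" for i t
  proof -
    have "continuous_on V (\<lambda>x. if i = s then D t x else 0)" "continuous_on V (\<lambda>x. if t = s then D i x else 0)"
      using cD that by (cases "i = s"; cases "t = s"; simp)+
    then show ?thesis
      unfolding E'_def[abs_def] using that E(2) by (intro continuous_intros) auto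
  qed
  moreover have "\<xi> s x *\<^sub>R l x + 2 *\<^sub>R D s x = (\<Sum>i\<le>m. E' i i x)" if "x \<in> V" for x
  proof -
    have "(\<Sum>i\<le>m. if i = s then D i x else 0) = D s x"
      using assms(2) by simp
    then show ?thesis
      unfolding E'_def sum.distrib E(3)[OF that] by (simp add: scaleR_sum_right scaleR_2)
  qed
  ultimately show ?thesis
    by (intro C2I[where E = E'] gradient_coord_scaleR D assms(2))
qed

lemma neg_lap_eq_sum: "neg_lap v p g = (\<lambda>x. \<Sum>i\<le>p. - pd (v i) (pd (v i) g) x)"
  by (simp add: neg_lap_def lap_p_def sum_negf)

text \<open>Put h = -\<Delta>_p g. Directions up to \<open>p\<close> contribute -S j h, those beyond
  contribute q S (j+1) h + R S (j+2) (-\<Delta>_p h). By the recurrence the last term is S j h -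
  (2j+1) S (j+1) h, so S j h cancels and the scalar q - 1 - 2j remains.\<close>

lemma C2_bessel_series:
  assumes g: "regular g"
  shows "C2 (bessel_series j g) (\<lambda>i x. if i \<le> p then bessel_series j (pd (v i) g) x else \<xi> i x *\<^sub>R bessel_series (Suc j) (neg_lap v p g) x)
    (\<lambda>x. (real (m - p) - 1 - 2 * real j) *\<^sub>R bessel_series (Suc j) (neg_lap v p g) x)"
proof -
  let ?h = "neg_lap v p g"
  let ?D = "\<lambda>j g i x. if i \<le> p then bessel_series j (pd (v i) g) x else \<xi> i x *\<^sub>R bessel_series (Suc j) (neg_lap v p g) x"
  define E where "E i t x = (if i \<le> p then ?D j (pd (v i) g) t x
     else (if t = i then bessel_series (Suc j) ?h x else 0) + \<xi> i x *\<^sub>R ?D (Suc j) ?h t x)" for i t x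
  have "gradient_at m (?D j g i) (\<lambda>t. E i t x) x" if "i \<le> m" "x \<in> V" for i x
  proof (cases "i \<le> p")
    case True
    then show ?thesis
      unfolding E_def using gradient_bessel_series[OF regular_pd[OF g True] that(2)] by simp
  next
    case False
    then show ?thesis
      unfolding E_def using gradient_coord_scaleR[OF gradient_bessel_series[OF regular_neg_lap[OF g] that(2)] that(1)] by simp
  qed
  moreover have "continuous_on V (E i t)" if "i \<le> m" "t \<le> m" for i t
  proof -
    have *: "continuous_on V (?D j g t)" if "regular g" for j g
      using that continuous_on_bessel_series regular_pd regular_neg_lap
      by (cases "t \<le> p") (auto intro!: continuous_intros)
    show ?thesis
    proof (cases "i \<le> p")
      case True
      then show ?thesis
        unfolding E_def[abs_def] using *[OF regular_pd[OF g]] by simp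
    next
      case False
      have "continuous_on V (\<lambda>x. if t = i then bessel_series (Suc j) ?h x else 0)"
        using continuous_on_bessel_series[OF regular_neg_lap[OF g]] by (cases "t = i") auto
      then have "continuous_on V (\<lambda>x. (if t = i then bessel_series (Suc j) ?h x else 0) + \<xi> i x *\<^sub>R ?D (Suc j) ?h t x)"
        by (intro continuous_on_add continuous_on_scaleR continuous_on_\<xi> continuous_on_id *[OF regular_neg_lap[OF g]])
      then show ?thesis
        using False by (simp only: E_def[abs_def] if_False)
    qed
  qed
  moreover have "(real (m - p) - 1 - 2 * real j) *\<^sub>R bessel_series (Suc j) ?h x = (\<Sum>i\<le>m. E i i x)" if x: "x \<in> V" for x
  proof -
    have "bessel_series j ?h x = (\<Sum>i\<le>p. - bessel_series j (pd (v i) (pd (v i) g)) x)"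
      unfolding neg_lap_eq_sum using g by (intro bessel_series_lin x regular_pd linear_uminus) auto
    then have "(\<Sum>i\<le>p. E i i x) = - bessel_series j ?h x"
      by (simp add: E_def sum_negf)
    moreover have "(\<Sum>i\<in>{p+1..m}. E i i x) = real (m - p) *\<^sub>R bessel_series (Suc j) ?h x + rad2 x *\<^sub>R bessel_series (Suc (Suc j)) (neg_lap v p ?h) x"
      by (simp add: E_def sum.distrib rad2_def scaleR_sum_left power2_eq_square sum_constant_scaleR)
    ultimately show ?thesis
      unfolding sum_split_p bessel_series_recurrence[OF regular_neg_lap[OF g] x] by (simp add: algebra_simps)
  qed
  ultimately show ?thesis
    by (intro C2I[where E = E] gradient_bessel_series[OF g])
qed

text \<open>The series of index j + 1 alone would give q - 3 - 2j. The cross term 2 \<partial>_s of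
  the product rule adds 2, which restores the factor of the even part.\<close>

lemma C2_coord_bessel_series:
  assumes "regular g" "s \<in> {p+1..m}"
  shows "\<exists>D. C2 (\<lambda>x. \<xi> s x *\<^sub>R bessel_series (Suc j) g x) D
    (\<lambda>x. (real (m - p) - 1 - 2 * real j) *\<^sub>R (\<xi> s x *\<^sub>R bessel_series (Suc (Suc j)) (neg_lap v p g) x))"
proof -
  have "\<xi> s x *\<^sub>R ((real (m - p) - 1 - 2 * real (Suc j)) *\<^sub>R y) + 2 *\<^sub>R (\<xi> s x *\<^sub>R y) =
     (real (m - p) - 1 - 2 * real j) *\<^sub>R (\<xi> s x *\<^sub>R y)" for x y :: 'a
    unfolding scaleR_scaleR scaleR_left_distrib[symmetric]
    by (intro arg_cong2[where f = scaleR] refl) (simp add: algebra_simps)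
  then show ?thesis
    using C2_coord_scaleR[OF C2_bessel_series[OF assms(1), of "Suc j"], of s] assms(2) by auto
qed

section \<open>The domain\<close>

definition \<Omega> :: "'a set" where "\<Omega> = V \<inter> Mspace v m"

definition xq :: "'a \<Rightarrow> 'a" where "xq x = (\<Sum>s\<in>{p+1..m}. \<xi> s x *\<^sub>R v s)"

lemma \<xi>_expansion: "x \<in> Mspace v m \<Longrightarrow> x = (\<Sum>s\<le>m. \<xi> s x *\<^sub>R v s)"
  unfolding Mspace_def
proof (induction x rule: span_induct_alt)
  case base
  then show ?case by simp
next
  case (step c x y)
  then obtain t where t: "t \<le> m" "x = v t" by auto
  have "(\<Sum>s\<le>m. \<xi> s (v t) *\<^sub>R v s) = (\<Sum>s\<le>m. if s = t then v t else 0)"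
    using t by (intro sum.cong) (auto simp: \<xi>_v)
  then have "(\<Sum>s\<le>m. \<xi> s (c *\<^sub>R x + y) *\<^sub>R v s) = c *\<^sub>R x + (\<Sum>s\<le>m. \<xi> s y *\<^sub>R v s)"
    using t by (simp add: scaleR_add_left sum.distrib flip: scaleR_scaleR scaleR_sum_right)
  then show ?case using step.IH by simp
qed

lemma \<xi>_sum_v: "A \<subseteq> {..m} \<Longrightarrow> s \<le> m \<Longrightarrow> \<xi> s (\<Sum>t\<in>A. c t *\<^sub>R v t) = (if s \<in> A then c s else 0)"
proof -
  assume A: "A \<subseteq> {..m}" "s \<le> m"
  then have "(\<Sum>t\<in>A. c t * \<xi> s (v t)) = (\<Sum>t\<in>A. if t = s then c s else 0)"
    by (intro sum.cong) (auto simp: \<xi>_v)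
  moreover have "finite A" using A finite_subset by blast
  ultimately show ?thesis by simp
qed

lemma coords_eq:
  assumes "x \<in> Mspace v m" "s \<le> m"
  shows "coords v m x s = \<xi> s x"
proof -
  have "coords v m x = (\<lambda>s. if s \<le> m then \<xi> s x else 0)"
    unfolding coords_def
  proof (rule the_equality)
    show "(\<forall>s. m < s \<longrightarrow> (if s \<le> m then \<xi> s x else 0) = 0) \<and> x = (\<Sum>s\<le>m. (if s \<le> m then \<xi> s x else 0) *\<^sub>R v s)"
      using \<xi>_expansion[OF assms(1)] by simp
    fix c :: "nat \<Rightarrow> real"
    assume c: "(\<forall>s. m < s \<longrightarrow> c s = 0) \<and> x = (\<Sum>s\<le>m. c s *\<^sub>R v s)"
    show "c = (\<lambda>s. if s \<le> m then \<xi> s x else 0)"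
    proof
      fix s
      show "c s = (if s \<le> m then \<xi> s x else 0)"
        using c \<xi>_sum_v[of "{..m}" s c] by (cases "s \<le> m") auto
    qed
  qed
  then show ?thesis using assms by simp
qed

lemma parts_eq:
  assumes "x \<in> Mspace v m"
  shows "xpart v m p x = proj x" "xqpart v m p x = xq x" "rad v m p x = sqrt (rad2 x)"
    "xdiamond v m p x = proj x - xq x"
  using p_less_m assms
  by (simp_all add: xpart_def xqpart_def rad_def xdiamond_def proj_def xq_def rad2_def coords_eq)

lemma Mspace_mono: "Mspace v p \<subseteq> Mspace v m"
  unfolding Mspace_def using p_less_m by (intro span_mono image_mono) auto

lemma Mspace_closed: "x \<in> Mspace v n \<Longrightarrow> y \<in> Mspace v n \<Longrightarrow> x + c *\<^sub>R y \<in> Mspace v n"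
  unfolding Mspace_def by (intro span_add span_scale)

lemma Sph_coords:
  assumes "\<omega> \<in> Sph v m p"
  shows "\<omega> \<in> Mspace v m" "proj \<omega> = 0" "rad2 \<omega> = 1" "xq \<omega> = \<omega>"
proof -
  obtain c where c: "\<omega> = (\<Sum>s\<in>{p+1..m}. c s *\<^sub>R v s)" "(\<Sum>s\<in>{p+1..m}. (c s)\<^sup>2) = 1"
    using assms by (auto simp: Sph_def)
  have \<xi>: "\<xi> s \<omega> = (if s \<in> {p+1..m} then c s else 0)" if "s \<le> m" for s
    unfolding c(1) using that by (intro \<xi>_sum_v) auto
  show "\<omega> \<in> Mspace v m"
    unfolding c(1) Mspace_def by (intro span_sum span_scale span_base) auto
  show "proj \<omega> = 0" using p_less_m by (simp add: proj_def \<xi>)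
  show "rad2 \<omega> = 1" using c(2) by (simp add: rad2_def \<xi>)
  have "xq \<omega> = (\<Sum>s\<in>{p+1..m}. c s *\<^sub>R v s)" by (simp add: xq_def \<xi>)
  then show "xq \<omega> = \<omega>" using c(1) by (rule trans[OF _ sym])
qed

lemma Mspace_p_coords:
  assumes "x \<in> Mspace v p"
  shows "proj x = x" "s \<in> {p+1..m} \<Longrightarrow> \<xi> s x = 0" "rad2 x = 0" "xq x = 0"
proof -
  show 1: "proj x = x" using assms by (rule proj_Mspace)
  have 2: "\<xi> s x = 0" if "s \<in> {p+1..m}" for s
  proof -
    have "\<xi> s (proj x) = 0"
      unfolding proj_def using that p_less_m by (subst \<xi>_sum_v) auto
    then show ?thesis using 1 by simp
  qed
  then show "s \<in> {p+1..m} \<Longrightarrow> \<xi> s x = 0" .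
  show "rad2 x = 0" "xq x = 0" using 2 by (simp_all add: rad2_def xq_def)
qed

lemma slice_point:
  assumes "x \<in> Mspace v p" "\<omega> \<in> Sph v m p"
  shows "proj (x + r *\<^sub>R \<omega>) = x" "rad2 (x + r *\<^sub>R \<omega>) = r\<^sup>2" "xq (x + r *\<^sub>R \<omega>) = r *\<^sub>R \<omega>"
    "s \<in> {p+1..m} \<Longrightarrow> \<xi> s (x + r *\<^sub>R \<omega>) = r * \<xi> s \<omega>" "x + r *\<^sub>R \<omega> \<in> Mspace v m"
proof -
  show "proj (x + r *\<^sub>R \<omega>) = x" using assms by (simp add: Mspace_p_coords Sph_coords)
  show 1: "\<xi> s (x + r *\<^sub>R \<omega>) = r * \<xi> s \<omega>" if "s \<in> {p+1..m}" for s
    using Mspace_p_coords(2)[OF assms(1) that] by simp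
  have "rad2 (x + r *\<^sub>R \<omega>) = r\<^sup>2 * rad2 \<omega>"
    unfolding rad2_def by (simp add: 1 power_mult_distrib sum_distrib_left del: \<xi>_simps)
  then show "rad2 (x + r *\<^sub>R \<omega>) = r\<^sup>2" using Sph_coords[OF assms(2)] by simp
  have "xq (x + r *\<^sub>R \<omega>) = r *\<^sub>R xq \<omega>"
    unfolding xq_def by (simp add: 1 scaleR_sum_right del: \<xi>_simps)
  then show "xq (x + r *\<^sub>R \<omega>) = r *\<^sub>R \<omega>" using Sph_coords[OF assms(2)] by simp
  show "x + r *\<^sub>R \<omega> \<in> Mspace v m"
    using Mspace_closed Mspace_mono assms Sph_coords by blast
qed

lemma \<xi>_proj: "s \<le> p \<Longrightarrow> \<xi> s (proj x) = \<xi> s x"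
  unfolding proj_def using p_less_m by (subst \<xi>_sum_v) auto

text \<open>Membership in \<open>V\<close> is decided by \<open>proj\<close> and \<open>rad2\<close>
  and passes to smaller radii. The p-symmetry, the reflection and the retraction onto
  \<open>\<Omega>0\<close> all rest on this.\<close>

lemma V_iff_proj:
  assumes "proj x = proj y" "rad2 x \<le> rad2 y" "y \<in> V"
  shows "x \<in> V"
proof -
  have "\<xi> s x = \<xi> s y" if "s \<le> p" for s
    using \<xi>_proj[OF that] assms(1) by metis
  then show ?thesis using assms unfolding V_def by (force simp: cylinder_def)
qed

lemma proj_in_\<Omega>0: "x \<in> V \<Longrightarrow> proj x \<in> \<Omega>0"
  using proj_cylinder by (auto simp: V_def)

lemma \<Omega>0_sub_\<Omega>: "\<Omega>0 \<subseteq> \<Omega>"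
proof
  fix a assume a: "a \<in> \<Omega>0"
  then have "a \<in> Mspace v p" using \<Omega>0_sub by auto
  then show "a \<in> \<Omega>"
    using a in_own_cylinder[OF a] L_pos[OF a] Mspace_mono Mspace_p_coords(3)
    by (auto simp: \<Omega>_def V_def intro!: bexI[of _ a])
qed

text \<open>Every point of \<open>V\<close> retracts along a segment onto its projection in \<open>\<Omega>0\<close>.\<close>

lemma connected_V_Int:
  assumes "connected \<Omega>0" "\<Omega>0 \<noteq> {}" and N: "subspace N" "Mspace v p \<subseteq> N" "N \<subseteq> Mspace v m"
  shows "connected (V \<inter> N)"
proof -
  have \<Omega>0_V: "\<Omega>0 \<subseteq> V \<inter> N" using \<Omega>0_sub_\<Omega> \<Omega>0_sub N by (auto simp: \<Omega>_def)
  have seg: "closed_segment x (proj x) \<subseteq> V \<inter> N" if x: "x \<in> V \<inter> N" for x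
  proof
    fix y assume "y \<in> closed_segment x (proj x)"
    then obtain u where u: "0 \<le> u" "u \<le> 1" "y = (1 - u) *\<^sub>R x + u *\<^sub>R proj x"
      by (auto simp: closed_segment_def)
    have pp: "proj (proj x) = proj x" "\<And>s. s \<in> {p+1..m} \<Longrightarrow> \<xi> s (proj x) = 0"
      using Mspace_p_coords[OF proj_in_Mspace] by auto
    have "proj y = (1 - u) *\<^sub>R proj x + u *\<^sub>R proj (proj x)" using u(3) by simp
    then have "proj y = proj x" using pp by (simp add: algebra_simps)
    moreover have "rad2 y \<le> rad2 x"
      unfolding rad2_def
    proof (rule sum_mono)
      fix s assume "s \<in> {p+1..m}"
      then have "(\<xi> s y)\<^sup>2 = (1 - u)\<^sup>2 * (\<xi> s x)\<^sup>2"
        using u pp by (simp add: power_mult_distrib)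
      also have "\<dots> \<le> 1 * (\<xi> s x)\<^sup>2"
        using u by (intro mult_right_mono) (auto simp: power_le_one)
      finally show "(\<xi> s y)\<^sup>2 \<le> (\<xi> s x)\<^sup>2" by simp
    qed
    ultimately have "y \<in> V" using V_iff_proj x by blast
    moreover have "y \<in> N"
      unfolding u using x N proj_in_Mspace by (intro subspace_add subspace_scale) auto
    ultimately show "y \<in> V \<inter> N" by simp
  qed
  have "V \<inter> N = (\<Union>x\<in>V \<inter> N. closed_segment x (proj x) \<union> \<Omega>0)"
    using seg \<Omega>0_V by auto
  moreover have "connected (\<Union>x\<in>V \<inter> N. closed_segment x (proj x) \<union> \<Omega>0)"
  proof (rule connected_Union)
    show "connected T" if "T \<in> (\<lambda>x. closed_segment x (proj x) \<union> \<Omega>0) ` (V \<inter> N)" for T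
      using that assms(1) proj_in_\<Omega>0 by (auto intro!: connected_Un)
    show "\<Inter> ((\<lambda>x. closed_segment x (proj x) \<union> \<Omega>0) ` (V \<inter> N)) \<noteq> {}"
      using assms(2) by blast
  qed
  ultimately show ?thesis by simp
qed

lemma slice_plane_sub:
  assumes "\<omega> \<in> Sph v m p"
  shows "slice_plane v p \<omega> \<subseteq> Mspace v m" "Mspace v p \<subseteq> slice_plane v p \<omega>" "subspace (slice_plane v p \<omega>)"
proof -
  show "slice_plane v p \<omega> \<subseteq> Mspace v m"
    unfolding slice_plane_def
  proof (rule span_minimal)
    show "insert \<omega> (v ` {0..p}) \<subseteq> Mspace v m"
      using Sph_coords(1)[OF assms] p_less_m by (auto simp: Mspace_def intro!: span_base)
  qed (simp add: Mspace_def)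
  show "Mspace v p \<subseteq> slice_plane v p \<omega>"
    unfolding slice_plane_def Mspace_def by (intro span_mono) auto
  show "subspace (slice_plane v p \<omega>)" by (simp add: slice_plane_def)
qed

lemma slice_of_eq: "\<omega> \<in> Sph v m p \<Longrightarrow> slice_of v p \<Omega> \<omega> = V \<inter> slice_plane v p \<omega>"
  using slice_plane_sub(1) by (auto simp: slice_of_def \<Omega>_def)

lemma slice_plane_point:
  assumes "x \<in> slice_plane v p \<omega>"
  obtains y t where "y \<in> Mspace v p" "x = y + t *\<^sub>R \<omega>"
  using span_breakdown_eq[of x \<omega> "v ` {0..p}"] assms that[of "x - _ *\<^sub>R \<omega>"]
  unfolding slice_plane_def Mspace_def by force

text \<open>Connectedness of the domain and of its slices are instances of
  \<open>connected_V_Int\<close>, with N = M and with N a slice plane.\<close>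

lemma \<Omega>_topology:
  assumes "connected \<Omega>0" "\<Omega>0 \<noteq> {}"
  shows "openin (top_of_set (Mspace v m)) \<Omega>" "connected \<Omega>" "p_symmetric v m p \<Omega>" "slice_domain v m p \<Omega>"
proof -
  show "openin (top_of_set (Mspace v m)) \<Omega>"
    unfolding \<Omega>_def using openin_open_Int[OF open_V] by (simp add: Int_commute)
  show "connected \<Omega>"
    unfolding \<Omega>_def by (intro connected_V_Int assms Mspace_mono) (auto simp: Mspace_def)
  show "p_symmetric v m p \<Omega>"
    unfolding p_symmetric_def \<Omega>_def
  proof (intro ballI allI impI IntI)
    fix xp r \<omega> \<eta>
    assume *: "xp \<in> Mspace v p" "\<omega> \<in> Sph v m p" "\<eta> \<in> Sph v m p" "xp + r *\<^sub>R \<omega> \<in> V \<inter> Mspace v m"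
    show "xp + r *\<^sub>R \<eta> \<in> V"
    proof (rule V_iff_proj)
      show "proj (xp + r *\<^sub>R \<eta>) = proj (xp + r *\<^sub>R \<omega>)" "rad2 (xp + r *\<^sub>R \<eta>) \<le> rad2 (xp + r *\<^sub>R \<omega>)"
        by (simp_all only: slice_point(1,2)[OF *(1,2)] slice_point(1,2)[OF *(1,3)])
    qed (use * in blast)
    show "xp + r *\<^sub>R \<eta> \<in> Mspace v m" by (rule slice_point(5)[OF *(1,3)])
  qed
  show "slice_domain v m p \<Omega>"
    unfolding slice_domain_def
  proof (intro conjI ballI)
    show "\<Omega> \<inter> Mspace v p \<noteq> {}" using assms \<Omega>0_sub \<Omega>0_sub_\<Omega> by blast
    fix \<omega> assume \<omega>: "\<omega> \<in> Sph v m p"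
    show "slice_of v p \<Omega> \<omega> \<noteq> {}"
      using assms(2) \<Omega>0_sub \<Omega>0_sub_\<Omega> slice_plane_sub(2)[OF \<omega>] unfolding slice_of_def by blast
    show "openin (top_of_set (slice_plane v p \<omega>)) (slice_of v p \<Omega> \<omega>)"
      unfolding slice_of_eq[OF \<omega>] using openin_open_Int[OF open_V] by (simp add: Int_commute)
    show "connected (slice_of v p \<Omega> \<omega>)"
      unfolding slice_of_eq[OF \<omega>] by (intro connected_V_Int assms slice_plane_sub \<omega>)
  qed
qed

section \<open>Transfer of derivatives from \<open>V\<close> to the relatively open domain\<close>

lemma eventually_\<Omega>:
  assumes "x \<in> \<Omega>" "u \<in> Mspace v m"
  shows "\<forall>\<^sub>F t in nhds 0. x + t *\<^sub>R u \<in> \<Omega>"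
proof -
  have "((\<lambda>t. x + t *\<^sub>R u) \<longlongrightarrow> x + 0 *\<^sub>R u) (nhds (0::real))"
    by (intro tendsto_intros filterlim_ident)
  then have "\<forall>\<^sub>F t in nhds 0. x + t *\<^sub>R u \<in> V"
    using assms open_V by (intro topological_tendstoD) (auto simp: \<Omega>_def)
  then show ?thesis
    by eventually_elim (use assms Mspace_closed in \<open>auto simp: \<Omega>_def\<close>)
qed

text \<open>\<open>f\<close> is controlled only on \<open>\<Omega>\<close>, whereas
  \<open>f'\<close> is differentiable in the full space. A line in a direction of M stays in
  \<open>\<Omega>\<close> for small parameters, and its germ carries the derivative over.\<close>

lemma pd_on_\<Omega>:
  assumes eq: "\<forall>x\<in>\<Omega>. f x = f' x" and x: "x \<in> \<Omega>" and u: "u \<in> Mspace v m"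
    and grad: "gradient_at m f' D x"
  shows "pd u f x = (\<Sum>i\<le>m. \<xi> i u *\<^sub>R D i)" "has_pd u f x"
proof -
  have "\<forall>\<^sub>F t in nhds 0. f (x + t *\<^sub>R u) = f' (x + t *\<^sub>R u)"
    using eventually_\<Omega>[OF x u] by eventually_elim (rule eq[rule_format])
  from pd_cong[OF this] pd_of_gradient[OF grad, of u]
  show "pd u f x = (\<Sum>i\<le>m. \<xi> i u *\<^sub>R D i)" "has_pd u f x" by auto
qed

lemma pd_v_on_\<Omega>:
  assumes eq: "\<forall>x\<in>\<Omega>. f x = f' x" and x: "x \<in> \<Omega>" and s: "s \<le> m"
    and grad: "gradient_at m f' D x"
  shows "pd (v s) f x = D s" "has_pd (v s) f x"
proof -
  have "v s \<in> Mspace v m" using s by (auto simp: Mspace_def intro: span_base)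
  note * = pd_on_\<Omega>[OF eq x this grad]
  have "(\<Sum>i\<le>m. \<xi> i (v s) *\<^sub>R D i) = (\<Sum>i\<le>m. if i = s then D s else 0)"
    using s by (intro sum.cong) (auto simp: \<xi>_v)
  then show "pd (v s) f x = D s" using *(1) s by simp
  show "has_pd (v s) f x" by (rule *(2))
qed

lemma C2_harmonic_data:
  assumes C: "C2 f' D l" and eq: "\<And>x. x \<in> \<Omega> \<Longrightarrow> f x = f' x"
  shows "Ck_dir (v ` {0..m}) 2 \<Omega> f" "\<And>x. x \<in> \<Omega> \<Longrightarrow> lap_p v m f x = l x"
proof -
  have "Ck_dir (v ` {0..m}) 2 \<Omega> f \<and> (\<forall>x\<in>\<Omega>. lap_p v m f x = l x)"
    using C
  proof (rule C2E)
    fix E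
    assume D: "\<And>x. x \<in> V \<Longrightarrow> gradient_at m f' (\<lambda>i. D i x) x"
      and E: "\<And>i x. i \<le> m \<Longrightarrow> x \<in> V \<Longrightarrow> gradient_at m (D i) (\<lambda>t. E i t x) x"
      "\<And>i t. i \<le> m \<Longrightarrow> t \<le> m \<Longrightarrow> continuous_on V (E i t)"
      "\<And>x. x \<in> V \<Longrightarrow> l x = (\<Sum>i\<le>m. E i i x)"
    have \<Omega>V: "x \<in> \<Omega> \<Longrightarrow> x \<in> V" for x by (simp add: \<Omega>_def)
    have cont: "continuous_on \<Omega> g" if "continuous_on V g'" "\<And>x. x \<in> \<Omega> \<Longrightarrow> g x = g' x" for g g' :: "'a \<Rightarrow> 'a"
      by (rule continuous_on_eq[OF continuous_on_subset[OF that(1)]]) (auto simp: \<Omega>_def that(2))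
    have 1: "pd (v s) f x = D s x" "has_pd (v s) f x" if "x \<in> \<Omega>" "s \<le> m" for x s
      using pd_v_on_\<Omega>[OF _ that D[OF \<Omega>V[OF that(1)]], of f] eq by blast+
    \<comment> \<open>\<open>pd (v s) f\<close> is again identified with \<open>D s\<close> only on
      \<open>\<Omega>\<close>, so the same transfer is repeated.\<close>
    have 2: "pd (v t) (pd (v s) f) x = E s t x" "has_pd (v t) (pd (v s) f) x" if "x \<in> \<Omega>" "s \<le> m" "t \<le> m" for x s t
      using pd_v_on_\<Omega>[OF _ that(1,3) E(1)[OF that(2) \<Omega>V[OF that(1)]], of "pd (v s) f"] 1(1) that by blast+
    have c0: "continuous_on \<Omega> f"
      using cont[OF continuous_on_gradient[OF D] eq] .
    have c1: "continuous_on \<Omega> (pd (v s) f)" if "s \<le> m" for s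
      using cont[OF continuous_on_gradient[OF E(1)[OF that]] 1(1)[OF _ that]] .
    have c2: "continuous_on \<Omega> (pd (v t) (pd (v s) f))" if "s \<le> m" "t \<le> m" for s t
      using cont[OF E(2)[OF that] 2(1)[OF _ that]] .
    have "Ck_dir (v ` {0..m}) 2 \<Omega> f"
      unfolding numeral_2_eq_2 using c0 c1 c2 1(2) 2(2) by simp
    moreover have "lap_p v m f x = l x" if "x \<in> \<Omega>" for x
      unfolding lap_p_def E(3)[OF \<Omega>V[OF that]] using 2(1)[OF that] by (intro sum.cong) auto
    ultimately show ?thesis by blast
  qed
  then show "Ck_dir (v ` {0..m}) 2 \<Omega> f" "\<And>x. x \<in> \<Omega> \<Longrightarrow> lap_p v m f x = l x" by auto
qed

text \<open>The chain \<open>h\<close> gives every Laplace power a representative on the open set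
  \<open>V\<close> before the next Laplacian is taken; the values of the powers off
  \<open>\<Omega>\<close> stay uncontrolled.\<close>

lemma lap_power_on_\<Omega>:
  assumes "\<And>i. \<exists>D. C2 (h i) D (h (Suc i))" and "\<And>x. x \<in> \<Omega> \<Longrightarrow> f x = h 0 x"
  shows "x \<in> \<Omega> \<Longrightarrow> (lap_p v m ^^ i) f x = h i x"
proof (induction i arbitrary: x)
  case (Suc i)
  obtain D where "C2 (h i) D (h (Suc i))" using assms(1) by blast
  then show ?case using C2_harmonic_data(2)[of "h i"] Suc by auto
qed (use assms(2) in simp)

text \<open>A family with centre in \<open>\<Omega>0\<close> sees only values on
  \<open>\<Omega>0\<close>, so one that represents \<open>g\<close> also represents
  \<open>g'\<close>, and both series are computed from it.\<close>

lemma bessel_series_cong: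
  assumes "regular g" "\<And>y. y \<in> \<Omega>0 \<Longrightarrow> g y = g' y" "x \<in> V"
  shows "bessel_series j g x = bessel_series j g' x"
proof -
  obtain a where a: "a \<in> \<Omega>0" "x \<in> cylinder a (\<sigma> a)"
    using assms by (auto simp: V_def)
  obtain F where F: "represents a F g" using assms a by (auto simp: regular_def)
  then have "represents a F g'" using assms(2) a proj_cylinder by (simp add: represents_def)
  then show ?thesis using bessel_series_represents[OF F a(2)] bessel_series_represents[of a F g'] a by simp
qed

lemma pd_lin:
  fixes T :: "'i \<Rightarrow> 'a \<Rightarrow> 'a"
  assumes A: "finite A" and g: "\<And>i. i \<in> A \<Longrightarrow> regular (g i)" and T: "\<And>i. i \<in> A \<Longrightarrow> linear (T i)"
    and y: "y \<in> \<Omega>0" and s: "s \<le> p"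
  shows "pd (v s) (\<lambda>x. \<Sum>i\<in>A. T i (g i x)) y = (\<Sum>i\<in>A. T i (pd (v s) (g i) y))"
proof -
  have "\<forall>i\<in>A. \<exists>F. represents y F (g i)" using g y by (auto simp: regular_def)
  then obtain F where F: "\<And>i. i \<in> A \<Longrightarrow> represents y (F i) (g i)" by metis
  have *: "y \<in> cylinder y (\<sigma> y)" "proj y = y" using y in_own_cylinder \<Omega>0_sub proj_Mspace by auto
  have rep: "represents y (\<lambda>\<beta> x. \<Sum>i\<in>A. T i (F i \<beta> x)) (\<lambda>x. \<Sum>i\<in>A. T i (g i x))"
    using y A F T by (rule represents_lin)
  have "(\<Sum>i\<in>A. T i (F i {#s#} y)) = pd (v s) (\<lambda>x. \<Sum>i\<in>A. T i (g i x)) (proj y)"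
    using represents_pd[OF rep s] *(1) unfolding represents_def by blast
  moreover have "F i {#s#} y = pd (v s) (g i) (proj y)" if "i \<in> A" for i
    using represents_pd[OF F[OF that] s] *(1) unfolding represents_def by blast
  ultimately show ?thesis using *(2) by simp
qed

end

section \<open>The Cauchy-Kovalevskaya extension\<close>

text \<open>All that is kept of the algebra is bilinearity, the unit v_0 and the Clifford relations
  for the operators of left multiplication by v_1, ..., v_m.\<close>

locale slice_algebra = analytic_neighbourhoods +
  fixes mul :: "'a \<Rightarrow> 'a \<Rightarrow> 'a" and f0 :: "'a \<Rightarrow> 'a"
  assumes bilinear_mul: "bilinear mul" and regular_f0: "regular f0"
    and mul_v_0: "mul (v 0) a = a"
    and mul_v_mul_v: "s \<in> {1..m} \<Longrightarrow> t \<in> {1..m} \<Longrightarrow>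
      mul (v s) (mul (v t) a) + mul (v t) (mul (v s) a) = (if s = t then - (2 *\<^sub>R a) else 0)"
begin

section \<open>Consequences of the Clifford relations\<close>

lemma linear_mul: "linear (mul u)" "linear (\<lambda>u. mul u a)"
  using bilinear_mul by (auto simp: bilinear_def)

lemmas mul_simps =
  linear_add[OF linear_mul(1)] linear_cmul[OF linear_mul(1)] linear_neg[OF linear_mul(1)]
  linear_0[OF linear_mul(1)] linear_sum[OF linear_mul(1)]
  linear_add[OF linear_mul(2)] linear_cmul[OF linear_mul(2)] linear_0[OF linear_mul(2)] linear_sum[OF linear_mul(2)]

definition df where "df = D_p mul v p f0"

lemma df_eq: "df = (\<lambda>x. \<Sum>s\<in>{..p}. mul (v s) (pd (v s) f0 x))"
  by (simp add: df_def D_p_def fun_eq_iff)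

lemma regular_df: "regular df"
  unfolding df_eq by (intro regular_lin regular_pd regular_f0 linear_mul) auto

text \<open>For s \<le> m this is left multiplication by the conjugate of
  \<open>v s\<close>.\<close>

definition conj_v :: "nat \<Rightarrow> 'a \<Rightarrow> 'a" where
  "conj_v s a = (if s = 0 then a else - mul (v s) a)"

lemma linear_conj_v: "linear (conj_v s)"
proof (cases "s = 0")
  case True
  then show ?thesis by (simp add: conj_v_def[abs_def] linear_iff)
next
  case False
  then show ?thesis using linear_compose_neg[OF linear_mul(1)] by (simp add: conj_v_def[abs_def])
qed

text \<open>\<omega> combines v_t with t > p, which as operators anticommute with v_1, ..., v_p and
  commute with the unit v_0; \<open>conj_v\<close> records the sign.\<close>

lemma mul_v_mul_Sph:
  assumes "\<omega> \<in> Sph v m p" "s \<le> p"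
  shows "mul (v s) (mul \<omega> a) = mul \<omega> (conj_v s a)"
proof (cases "s = 0")
  case False
  have *: "mul (v s) (mul (v t) a) = - mul (v t) (mul (v s) a)" if "t \<in> {p+1..m}" for t
    using mul_v_mul_v[of s t a] that assms(2) False p_less_m by (auto simp: eq_neg_iff_add_eq_0)
  have "\<omega> = xq \<omega>" using Sph_coords[OF assms(1)] by simp
  then have \<omega>: "mul \<omega> b = (\<Sum>t\<in>{p+1..m}. \<xi> t \<omega> *\<^sub>R mul (v t) b)" for b
    unfolding xq_def by (metis (no_types, lifting) mul_simps(7) mul_simps(9) sum.cong)
  show ?thesis
    unfolding \<omega> using False * by (simp add: mul_simps conj_v_def sum_negf)
qed (simp add: mul_v_0 conj_v_def)

text \<open>Doubling the double sum and swapping its indices exhibits symmetrised products. Only the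
  diagonal survives, with total weight \<open>rad2 \<omega>\<close> = 1.\<close>

lemma mul_Sph_mul_Sph:
  assumes "\<omega> \<in> Sph v m p"
  shows "mul \<omega> (mul \<omega> a) = - a"
proof -
  let ?A = "{p+1..m}"
  have "\<omega> = xq \<omega>" using Sph_coords[OF assms(1)] by simp
  then have \<omega>: "mul \<omega> b = (\<Sum>t\<in>?A. \<xi> t \<omega> *\<^sub>R mul (v t) b)" for b
    unfolding xq_def by (metis (no_types, lifting) mul_simps(7) mul_simps(9) sum.cong)
  let ?X = "\<lambda>s t. (\<xi> s \<omega> * \<xi> t \<omega>) *\<^sub>R mul (v s) (mul (v t) a)"
  have e: "mul \<omega> (mul \<omega> a) = (\<Sum>s\<in>?A. \<Sum>t\<in>?A. ?X s t)"
    unfolding \<omega> by (simp add: mul_simps scaleR_sum_right)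
  have "2 *\<^sub>R mul \<omega> (mul \<omega> a) = (\<Sum>s\<in>?A. \<Sum>t\<in>?A. ?X s t) + (\<Sum>s\<in>?A. \<Sum>t\<in>?A. ?X t s)"
    unfolding e scaleR_2 by (subst (2) sum.swap) simp
  also have "\<dots> = (\<Sum>s\<in>?A. \<Sum>t\<in>?A. (\<xi> s \<omega> * \<xi> t \<omega>) *\<^sub>R (mul (v s) (mul (v t) a) + mul (v t) (mul (v s) a)))"
    by (simp add: sum.distrib scaleR_add_right mult.commute)
  also have "\<dots> = (\<Sum>s\<in>?A. \<Sum>t\<in>?A. if s = t then - ((2 * (\<xi> s \<omega>)\<^sup>2) *\<^sub>R a) else 0)"
    by (intro sum.cong refl, subst mul_v_mul_v) (auto simp: power2_eq_square)
  also have "\<dots> = (- 2 * rad2 \<omega>) *\<^sub>R a"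
    by (simp add: rad2_def sum_distrib_left sum_negf scaleR_sum_left)
  finally have "2 *\<^sub>R mul \<omega> (mul \<omega> a) = 2 *\<^sub>R (- a)" using Sph_coords(3)[OF assms] by simp
  then show ?thesis by (simp only: scaleR_cancel_left) simp
qed

text \<open>The factorisation conj(D) D = \<Delta>_p, for a symmetric array \<open>h\<close>
  standing for the second partials. Symmetrising removes the off-diagonal terms: by the Clifford
  relations for s, t \<ge> 1, and by the sign in \<open>conj_v\<close> if exactly one index is
  0.\<close>

lemma conj_Dirac_squared:
  assumes sym: "\<And>s t. s \<le> p \<Longrightarrow> t \<le> p \<Longrightarrow> h s t = h t s"
  shows "(\<Sum>s\<le>p. conj_v s (\<Sum>t\<le>p. mul (v t) (h s t))) = (\<Sum>s\<le>p. h s s)"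
proof -
  let ?X = "\<lambda>s t. conj_v s (mul (v t) (h s t))"
  have pair: "?X s t + ?X t s = (if s = t then 2 *\<^sub>R h s s else 0)" if st: "s \<le> p" "t \<le> p" for s t
  proof -
    have h: "h t s = h s t" using sym st by simp
    consider "s = 0" | "t = 0" | "s \<in> {1..m}" "t \<in> {1..m}" using st p_less_m by force
    then show ?thesis
    proof cases
      case 3
      then have "?X s t + ?X t s = - (mul (v s) (mul (v t) (h s t)) + mul (v t) (mul (v s) (h s t)))"
        by (simp add: conj_v_def h)
      then show ?thesis using mul_v_mul_v[OF 3] by (auto simp: h)
    qed (use h in \<open>auto simp: conj_v_def mul_v_0 scaleR_2\<close>)
  qed
  have e: "(\<Sum>s\<le>p. conj_v s (\<Sum>t\<le>p. mul (v t) (h s t))) = (\<Sum>s\<le>p. \<Sum>t\<le>p. ?X s t)"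
    by (simp add: linear_sum[OF linear_conj_v])
  have "2 *\<^sub>R (\<Sum>s\<le>p. \<Sum>t\<le>p. ?X s t) = (\<Sum>s\<le>p. \<Sum>t\<le>p. ?X s t) + (\<Sum>s\<le>p. \<Sum>t\<le>p. ?X t s)"
    unfolding scaleR_2 by (subst (2) sum.swap) simp
  also have "\<dots> = (\<Sum>s\<le>p. \<Sum>t\<le>p. if s = t then 2 *\<^sub>R h s s else 0)"
    unfolding sum.distrib[symmetric] using pair by (intro sum.cong) auto
  also have "\<dots> = 2 *\<^sub>R (\<Sum>s\<le>p. h s s)"
    by (simp add: scaleR_sum_right)
  finally show ?thesis unfolding e by simp
qed

lemma bessel_series_df: "x \<in> V \<Longrightarrow> bessel_series j df x = (\<Sum>s\<le>p. mul (v s) (bessel_series j (pd (v s) f0) x))"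
  unfolding df_eq by (intro bessel_series_lin regular_pd regular_f0 linear_mul) auto

text \<open>The identity conj(D) D f0 = \<Delta>_p f0 is established on \<open>\<Omega>0\<close>;
  \<open>bessel_series_cong\<close> carries it under the series.\<close>

lemma conj_bessel_series_pd_df:
  assumes x: "x \<in> V"
  shows "(\<Sum>s\<le>p. conj_v s (bessel_series j (pd (v s) df) x)) = - bessel_series j (neg_lap v p f0) x"
proof -
  \<comment> \<open>The sum over the singleton {0} gives the right side the shape expected by
    \<open>bessel_series_lin\<close>.\<close>
  have "(\<Sum>s\<in>{..p}. conj_v s (pd (v s) df y)) = (\<Sum>i\<in>{0::nat}. - neg_lap v p f0 y)" if y: "y \<in> \<Omega>0" for y
  proof -
    have "(\<Sum>s\<le>p. conj_v s (pd (v s) df y)) = (\<Sum>s\<le>p. conj_v s (\<Sum>t\<le>p. mul (v t) (pd (v s) (pd (v t) f0) y)))"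
      unfolding df_eq
      by (intro sum.cong refl arg_cong[where f = "conj_v _"] pd_lin y regular_pd regular_f0 linear_mul) auto
    also have "\<dots> = lap_p v p f0 y"
      unfolding lap_p_def by (intro conj_Dirac_squared pd_commute regular_f0 y)
    finally show ?thesis by (simp add: neg_lap_def)
  qed
  then have "bessel_series j (\<lambda>y. \<Sum>s\<in>{..p}. conj_v s (pd (v s) df y)) x = bessel_series j (\<lambda>y. \<Sum>i\<in>{0::nat}. - neg_lap v p f0 y) x"
    by (intro bessel_series_cong x regular_lin regular_pd regular_df linear_conj_v) auto
  moreover have "bessel_series j (\<lambda>y. \<Sum>s\<in>{..p}. conj_v s (pd (v s) df y)) x = (\<Sum>s\<le>p. conj_v s (bessel_series j (pd (v s) df) x))"
    by (intro bessel_series_lin x regular_pd regular_df linear_conj_v) auto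
  moreover have "bessel_series j (\<lambda>y. \<Sum>i\<in>{0::nat}. - neg_lap v p f0 y) x = (\<Sum>i\<in>{0::nat}. - bessel_series j (neg_lap v p f0) x)"
    by (intro bessel_series_lin x regular_neg_lap regular_f0 linear_uminus) auto
  ultimately show ?thesis by simp
qed

section \<open>Laplace powers of the even and odd parts\<close>

text \<open>The closed form of the i-th Laplace power of the even part. Taking it as a definition
  reduces the induction to a comparison of consecutive indices.\<close>

definition even_lap :: "nat \<Rightarrow> 'a \<Rightarrow> 'a" where
  "even_lap i x = (\<Prod>l<i. real (m - p) - 1 - 2 * real l) *\<^sub>R bessel_series i ((neg_lap v p ^^ i) f0) x"

definition odd_lap :: "nat \<Rightarrow> 'a \<Rightarrow> 'a" where
  "odd_lap i x = (\<Prod>l<i. real (m - p) - 1 - 2 * real l) *\<^sub>R mul (xq x) (bessel_series (Suc i) ((neg_lap v p ^^ i) df) x)"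

text \<open>The constant linear maps are moved outside, so that the Laplacian acts on a coordinate
  times a series.\<close>

lemma mul_xq: "mul (xq x) a = (\<Sum>s\<in>{p+1..m}. mul (v s) (\<xi> s x *\<^sub>R a))"
  by (simp add: xq_def mul_simps)

lemma linear_scaleR_right: "linear (\<lambda>x::'a. c *\<^sub>R x)"
  by (simp add: bounded_linear.linear bounded_linear_scaleR_right)

lemma C2_even_lap: "\<exists>D. C2 (even_lap i) D (even_lap (Suc i))"
proof -
  let ?c = "\<lambda>i. \<Prod>l<i. real (m - p) - 1 - 2 * real l"
  let ?g = "(neg_lap v p ^^ i) f0"
  have "\<exists>D. C2 (\<lambda>x. ?c i *\<^sub>R bessel_series i ?g x) D (\<lambda>x. ?c i *\<^sub>R ((real (m - p) - 1 - 2 * real i) *\<^sub>R bessel_series (Suc i) (neg_lap v p ?g) x))"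
    using C2_linear[OF C2_bessel_series[OF regular_neg_lap_power[OF regular_f0]] linear_scaleR_right] by blast
  then show ?thesis
    by (simp add: even_lap_def[abs_def])
qed

lemma C2_odd_lap: "\<exists>D. C2 (odd_lap i) D (odd_lap (Suc i))"
proof -
  let ?c = "\<lambda>i. \<Prod>l<i. real (m - p) - 1 - 2 * real l" and ?d = "real (m - p) - 1 - 2 * real i"
  let ?g = "(neg_lap v p ^^ i) df"
  have "\<exists>D. C2 (\<lambda>x. mul (v s) (\<xi> s x *\<^sub>R bessel_series (Suc i) ?g x)) D
      (\<lambda>x. mul (v s) (?d *\<^sub>R (\<xi> s x *\<^sub>R bessel_series (Suc (Suc i)) (neg_lap v p ?g) x)))" if s: "s \<in> {p+1..m}" for s
    using C2_coord_bessel_series[OF regular_neg_lap_power[OF regular_df] s] C2_linear[OF _ linear_mul(1)] by blast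
  then have "\<exists>D. C2 (\<lambda>x. \<Sum>s\<in>{p+1..m}. mul (v s) (\<xi> s x *\<^sub>R bessel_series (Suc i) ?g x)) D
      (\<lambda>x. \<Sum>s\<in>{p+1..m}. mul (v s) (?d *\<^sub>R (\<xi> s x *\<^sub>R bessel_series (Suc (Suc i)) (neg_lap v p ?g) x)))"
    by (intro C2_sum) auto
  then have "\<exists>D. C2 (\<lambda>x. ?c i *\<^sub>R (\<Sum>s\<in>{p+1..m}. mul (v s) (\<xi> s x *\<^sub>R bessel_series (Suc i) ?g x))) D
      (\<lambda>x. ?c i *\<^sub>R (\<Sum>s\<in>{p+1..m}. mul (v s) (?d *\<^sub>R (\<xi> s x *\<^sub>R bessel_series (Suc (Suc i)) (neg_lap v p ?g) x))))"
    using C2_linear[OF _ linear_scaleR_right[of "?c i"]] by blast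
  moreover have "?c i *\<^sub>R (\<Sum>s\<in>{p+1..m}. mul (v s) (?d *\<^sub>R (\<xi> s x *\<^sub>R a))) = ?c (Suc i) *\<^sub>R mul (xq x) a" for x a
    unfolding mul_xq linear_cmul[OF linear_mul(1), of _ ?d] scaleR_sum_right[symmetric] by simp
  ultimately show ?thesis
    by (simp add: odd_lap_def[abs_def] mul_xq)
qed

section \<open>Closed form and Dirac equation of the extension\<close>

text \<open>The weights 1/(2k)! and 1/(2k+1)! are \<open>bessel_coeff\<close> for j = 0 and j = 1.
  The odd power of r leaves one factor r, which later cancels the 1/r in \<omega> = x_q / r.\<close>

lemma CK_terms:
  assumes "x \<in> Mspace v m"
  shows "CK_even v m p f0 x k = (bessel_coeff 0 k * rad2 x ^ k) *\<^sub>R (neg_lap v p ^^ k) f0 (proj x)"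
    "CK_odd mul v m p f0 x k = sqrt (rad2 x) *\<^sub>R ((bessel_coeff 1 k * rad2 x ^ k) *\<^sub>R (neg_lap v p ^^ k) df (proj x))"
proof -
  have "sqrt (rad2 x) ^ (2 * k) = rad2 x ^ k"
    using rad2_nonneg by (simp add: power_mult)
  then show "CK_even v m p f0 x k = (bessel_coeff 0 k * rad2 x ^ k) *\<^sub>R (neg_lap v p ^^ k) f0 (proj x)"
    "CK_odd mul v m p f0 x k = sqrt (rad2 x) *\<^sub>R ((bessel_coeff 1 k * rad2 x ^ k) *\<^sub>R (neg_lap v p ^^ k) df (proj x))"
    unfolding CK_even_def CK_odd_def parts_eq[OF assms] neg_lap_def[symmetric] df_def[symmetric]
    by (simp_all add: bessel_coeff_def algebra_simps)
qed

lemma CK_summable: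
  assumes "x \<in> \<Omega>"
  shows "summable (CK_even v m p f0 x)" "summable (CK_odd mul v m p f0 x)"
proof -
  have x: "x \<in> Mspace v m" "x \<in> V" using assms by (auto simp: \<Omega>_def)
  show "summable (CK_even v m p f0 x)" "summable (CK_odd mul v m p f0 x)"
    unfolding CK_terms(1)[OF x(1), abs_def] CK_terms(2)[OF x(1), abs_def]
    by (intro summable_scaleR_right bessel_series_summable regular_f0 regular_df x)+
qed

lemma CK_eq:
  assumes "x \<in> \<Omega>"
  shows "CK mul v m p f0 x = even_lap 0 x + odd_lap 0 x"
proof -
  have x: "x \<in> Mspace v m" "x \<in> V" using assms by (auto simp: \<Omega>_def)
  have 1: "suminf (CK_even v m p f0 x) = bessel_series 0 f0 x"
    unfolding bessel_series_def by (rule arg_cong[where f = suminf], rule ext, rule CK_terms(1)[OF x(1)])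
  have "suminf (CK_odd mul v m p f0 x) = (\<Sum>k. sqrt (rad2 x) *\<^sub>R ((bessel_coeff 1 k * rad2 x ^ k) *\<^sub>R (neg_lap v p ^^ k) df (proj x)))"
    by (rule arg_cong[where f = suminf], rule ext, rule CK_terms(2)[OF x(1)])
  then have 2: "suminf (CK_odd mul v m p f0 x) = sqrt (rad2 x) *\<^sub>R bessel_series 1 df x"
    unfolding bessel_series_def by (simp only: suminf_scaleR_right[OF bessel_series_summable[OF regular_df x(2)]])
  \<comment> \<open>At r = 0 the quotient 1 / r has the value 0, and the closed form agrees with
    this because x_q = 0 there.\<close>
  have "xq x = 0" if "rad2 x = 0"
    using that unfolding rad2_def xq_def by (subst (asm) sum_nonneg_eq_0_iff) auto
  then show ?thesis
    unfolding CK_def 1 2 parts_eq[OF x(1)] by (auto simp: even_lap_def odd_lap_def mul_simps)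
qed

lemma gradient_CK:
  assumes x: "x \<in> V"
  shows "gradient_at m (\<lambda>x. even_lap 0 x + odd_lap 0 x) (\<lambda>i.
      (if i \<le> p then bessel_series 0 (pd (v i) f0) x else \<xi> i x *\<^sub>R bessel_series 1 (neg_lap v p f0) x) +
      (\<Sum>s\<in>{p+1..m}. mul (v s) ((if i = s then bessel_series 1 df x else 0) +
         \<xi> s x *\<^sub>R (if i \<le> p then bessel_series 1 (pd (v i) df) x else \<xi> i x *\<^sub>R bessel_series 2 (neg_lap v p df) x)))) x"
proof -
  have "gradient_at m (bessel_series 0 f0) (\<lambda>i. if i \<le> p then bessel_series 0 (pd (v i) f0) x else \<xi> i x *\<^sub>R bessel_series 1 (neg_lap v p f0) x) x"
    using gradient_bessel_series[OF regular_f0 x, of 0] by (simp only: One_nat_def)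
  moreover have g1: "gradient_at m (bessel_series 1 df) (\<lambda>i. if i \<le> p then bessel_series 1 (pd (v i) df) x else \<xi> i x *\<^sub>R bessel_series 2 (neg_lap v p df) x) x"
    using gradient_bessel_series[OF regular_df x, of 1] by (simp only: One_nat_def numeral_2_eq_2)
  have "((\<lambda>x. \<Sum>s\<in>{p+1..m}. mul (v s) (\<xi> s x *\<^sub>R bessel_series 1 df x)) has_derivative
      (\<lambda>h. \<Sum>s\<in>{p+1..m}. \<Sum>i\<le>m. \<xi> i h *\<^sub>R mul (v s) ((if i = s then bessel_series 1 df x else 0) +
         \<xi> s x *\<^sub>R (if i \<le> p then bessel_series 1 (pd (v i) df) x else \<xi> i x *\<^sub>R bessel_series 2 (neg_lap v p df) x)))) (at x)"
    by (intro has_derivative_sum gradient_linear[OF _ linear_mul(1)] gradient_coord_scaleR g1) auto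
  then have "gradient_at m (\<lambda>x. \<Sum>s\<in>{p+1..m}. mul (v s) (\<xi> s x *\<^sub>R bessel_series 1 df x)) (\<lambda>i. \<Sum>s\<in>{p+1..m}. mul (v s) ((if i = s then bessel_series 1 df x else 0) +
         \<xi> s x *\<^sub>R (if i \<le> p then bessel_series 1 (pd (v i) df) x else \<xi> i x *\<^sub>R bessel_series 2 (neg_lap v p df) x))) x"
    by (subst (asm) sum.swap) (simp only: scaleR_sum_right)
  ultimately show ?thesis
    unfolding even_lap_def[abs_def] odd_lap_def[abs_def] mul_xq
    by (intro gradient_add) simp_all
qed

text \<open>At x = y + t \<omega> the operator D gives S 0 df - t \<omega> S 1 (-\<Delta>_p f0),
  while \<omega> times the derivative along \<omega> gives t \<omega> S 1 (-\<Delta>_p f0) - S 1 df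
  - t^2 S 2 (-\<Delta>_p df). The recurrence with j = 0 makes the sum vanish.\<close>

lemma CK_Dirac:
  assumes \<omega>: "\<omega> \<in> Sph v m p" and x: "x \<in> slice_of v p \<Omega> \<omega>"
  shows "D_p mul v p (CK mul v m p f0) x + mul \<omega> (pd \<omega> (CK mul v m p f0) x) = 0"
proof -
  have x\<Omega>: "x \<in> \<Omega>" and xV: "x \<in> V" and xs: "x \<in> slice_plane v p \<omega>"
    using x by (auto simp: slice_of_def \<Omega>_def)
  obtain y t where y: "y \<in> Mspace v p" "x = y + t *\<^sub>R \<omega>"
    using slice_plane_point[OF xs] .
  \<comment> \<open>Here \<open>t\<close> is a signed coordinate with R = t^2; working with x_q = t
    \<omega> avoids division by the radius.\<close>
  have xq: "xq x = t *\<^sub>R \<omega>" "rad2 x = t\<^sup>2" and \<xi>x: "\<And>s. s \<in> {p+1..m} \<Longrightarrow> \<xi> s x = t * \<xi> s \<omega>"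
    unfolding y(2) using slice_point[OF y(1) \<omega>] by blast+
  define G where "G i = (if i \<le> p then bessel_series 0 (pd (v i) f0) x else \<xi> i x *\<^sub>R bessel_series 1 (neg_lap v p f0) x) +
      (\<Sum>s\<in>{p+1..m}. mul (v s) ((if i = s then bessel_series 1 df x else 0) +
         \<xi> s x *\<^sub>R (if i \<le> p then bessel_series 1 (pd (v i) df) x else \<xi> i x *\<^sub>R bessel_series 2 (neg_lap v p df) x)))" for i
  have grad: "gradient_at m (\<lambda>x. even_lap 0 x + odd_lap 0 x) G x"
    unfolding G_def by (rule gradient_CK[OF xV])
  have CK: "\<forall>x\<in>\<Omega>. CK mul v m p f0 x = even_lap 0 x + odd_lap 0 x"
    using CK_eq by blast
  have mul_xq_x: "(\<Sum>s\<in>{p+1..m}. mul (v s) (\<xi> s x *\<^sub>R a)) = t *\<^sub>R mul \<omega> a" for a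
    unfolding mul_xq[symmetric] xq by (simp add: mul_simps)
  have G1: "G i = bessel_series 0 (pd (v i) f0) x + t *\<^sub>R mul \<omega> (bessel_series 1 (pd (v i) df) x)" if "i \<le> p" for i
  proof -
    have "G i = bessel_series 0 (pd (v i) f0) x + (\<Sum>s\<in>{p+1..m}. mul (v s) (\<xi> s x *\<^sub>R bessel_series 1 (pd (v i) df) x))"
      unfolding G_def using that by (intro arg_cong2[where f = "(+)"] sum.cong) auto
    then show ?thesis by (simp only: mul_xq_x)
  qed
  have G2: "G i = (t * \<xi> i \<omega>) *\<^sub>R bessel_series 1 (neg_lap v p f0) x + mul (v i) (bessel_series 1 df x) + (t\<^sup>2 * \<xi> i \<omega>) *\<^sub>R mul \<omega> (bessel_series 2 (neg_lap v p df) x)"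
    if i: "i \<in> {p+1..m}" for i
  proof -
    have "G i = \<xi> i x *\<^sub>R bessel_series 1 (neg_lap v p f0) x + (\<Sum>s\<in>{p+1..m}. mul (v s) (if i = s then bessel_series 1 df x else 0)) +
        (\<Sum>s\<in>{p+1..m}. mul (v s) (\<xi> s x *\<^sub>R (\<xi> i x *\<^sub>R bessel_series 2 (neg_lap v p df) x)))"
      unfolding G_def using i by (simp add: mul_simps sum.distrib)
    moreover have "(\<Sum>s\<in>{p+1..m}. mul (v s) (if i = s then bessel_series 1 df x else 0)) = (\<Sum>s\<in>{p+1..m}. if i = s then mul (v i) (bessel_series 1 df x) else 0)"
      by (intro sum.cong) (auto simp: mul_simps)
    ultimately show ?thesis
      unfolding mul_xq_x using i by (simp add: \<xi>x mul_simps power2_eq_square mult_ac)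
  qed
  have D: "D_p mul v p (CK mul v m p f0) x = bessel_series 0 df x - t *\<^sub>R mul \<omega> (bessel_series 1 (neg_lap v p f0) x)"
  proof -
    have "D_p mul v p (CK mul v m p f0) x = (\<Sum>i\<le>p. mul (v i) (G i))"
      unfolding D_p_def using pd_v_on_\<Omega>(1)[OF CK x\<Omega> _ grad] p_less_m by (intro sum.cong) auto
    also have "\<dots> = (\<Sum>i\<le>p. mul (v i) (bessel_series 0 (pd (v i) f0) x)) + t *\<^sub>R (\<Sum>i\<le>p. mul (v i) (mul \<omega> (bessel_series 1 (pd (v i) df) x)))"
      by (simp add: G1 mul_simps sum.distrib scaleR_sum_right)
    also have "(\<Sum>i\<le>p. mul (v i) (mul \<omega> (bessel_series 1 (pd (v i) df) x))) = mul \<omega> (\<Sum>i\<le>p. conj_v i (bessel_series 1 (pd (v i) df) x))"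
      by (simp add: mul_v_mul_Sph[OF \<omega>] mul_simps)
    finally show ?thesis
      unfolding bessel_series_df[OF xV, symmetric] conj_bessel_series_pd_df[OF xV] by (simp add: mul_simps)
  qed
  have \<omega>0: "\<xi> i \<omega> = 0" if "i \<le> p" for i
    using Sph_coords(2)[OF \<omega>] \<xi>_proj[OF that, of \<omega>] by simp
  have c2: "(\<Sum>i\<in>{p+1..m}. \<xi> i \<omega> * \<xi> i \<omega>) = 1"
    using Sph_coords(3)[OF \<omega>] by (simp add: rad2_def power2_eq_square)
  have c1: "(\<Sum>i\<in>{p+1..m}. \<xi> i \<omega> *\<^sub>R mul (v i) a) = mul \<omega> a" for a
  proof -
    have "mul (xq \<omega>) a = (\<Sum>i\<in>{p+1..m}. \<xi> i \<omega> *\<^sub>R mul (v i) a)"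
      by (simp add: mul_xq mul_simps)
    then show ?thesis using Sph_coords(4)[OF \<omega>] by simp
  qed
  have "pd \<omega> (CK mul v m p f0) x = (\<Sum>i\<le>m. \<xi> i \<omega> *\<^sub>R G i)"
    by (rule pd_on_\<Omega>(1)[OF CK x\<Omega> Sph_coords(1)[OF \<omega>] grad])
  also have "\<dots> = (\<Sum>i\<in>{p+1..m}. \<xi> i \<omega> *\<^sub>R G i)"
    unfolding sum_split_p by (simp add: \<omega>0)
  also have "\<dots> = (\<Sum>i\<in>{p+1..m}. (\<xi> i \<omega> * \<xi> i \<omega>) *\<^sub>R (t *\<^sub>R bessel_series 1 (neg_lap v p f0) x) + \<xi> i \<omega> *\<^sub>R mul (v i) (bessel_series 1 df x) +
      (\<xi> i \<omega> * \<xi> i \<omega>) *\<^sub>R (t\<^sup>2 *\<^sub>R mul \<omega> (bessel_series 2 (neg_lap v p df) x)))"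
    by (intro sum.cong refl, subst G2) (auto simp: scaleR_add_right mult_ac)
  also have "\<dots> = t *\<^sub>R bessel_series 1 (neg_lap v p f0) x + mul \<omega> (bessel_series 1 df x) + t\<^sup>2 *\<^sub>R mul \<omega> (bessel_series 2 (neg_lap v p df) x)"
    unfolding sum.distrib scaleR_sum_left[symmetric] c2 c1 by simp
  finally have "mul \<omega> (pd \<omega> (CK mul v m p f0) x) = t *\<^sub>R mul \<omega> (bessel_series 1 (neg_lap v p f0) x) - bessel_series 1 df x - t\<^sup>2 *\<^sub>R bessel_series 2 (neg_lap v p df) x"
    by (simp add: mul_simps mul_Sph_mul_Sph[OF \<omega>])
  moreover have "t\<^sup>2 *\<^sub>R bessel_series 2 (neg_lap v p df) x = bessel_series 0 df x - bessel_series 1 df x"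
    using bessel_series_recurrence[OF regular_df xV, of 0] xq by (simp add: numeral_2_eq_2)
  ultimately show ?thesis using D by simp
qed

lemma CK_monogenic: "gps_monogenic mul v m p \<Omega> (CK mul v m p f0)"
  unfolding gps_monogenic_def
proof (intro ballI conjI CK_Dirac)
  fix \<omega> assume \<omega>: "\<omega> \<in> Sph v m p"
  let ?W = "slice_of v p \<Omega> \<omega>" and ?f = "CK mul v m p f0"
  have CK: "\<forall>x\<in>\<Omega>. ?f x = even_lap 0 x + odd_lap 0 x"
    using CK_eq by blast
  have W: "?W \<subseteq> \<Omega>" "?W \<subseteq> V" by (auto simp: slice_of_def \<Omega>_def)
  obtain D D' where "C2 (even_lap 0) D (even_lap 1)" "C2 (odd_lap 0) D' (odd_lap 1)"
    using C2_even_lap[of 0] C2_odd_lap[of 0] by auto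
  from C2_add[OF this] obtain D l where C2: "C2 (\<lambda>x. even_lap 0 x + odd_lap 0 x) D l" by blast
  show "Ck_dir (insert \<omega> (v ` {0..p})) 1 ?W ?f"
    using C2
  proof (rule C2E)
    fix E
    assume D: "\<And>x. x \<in> V \<Longrightarrow> gradient_at m (\<lambda>x. even_lap 0 x + odd_lap 0 x) (\<lambda>i. D i x) x"
      and E: "\<And>i x. i \<le> m \<Longrightarrow> x \<in> V \<Longrightarrow> gradient_at m (D i) (\<lambda>t. E i t x) x"
    have "continuous_on ?W ?f"
      by (rule continuous_on_eq[OF continuous_on_subset[OF continuous_on_gradient[OF D] W(2)]])
        (use CK W in auto)
    moreover have "has_pd u ?f x" "pd u ?f x = (\<Sum>i\<le>m. \<xi> i u *\<^sub>R D i x)" if "x \<in> ?W" "u \<in> Mspace v m" for x u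
    proof -
      have x: "x \<in> \<Omega>" "x \<in> V" using that W by auto
      show "has_pd u ?f x" "pd u ?f x = (\<Sum>i\<le>m. \<xi> i u *\<^sub>R D i x)"
        by (rule pd_on_\<Omega>[OF CK x(1) that(2) D[OF x(2)]])+
    qed
    moreover have "continuous_on ?W (pd u ?f)" if "u \<in> Mspace v m" for u
    proof (rule continuous_on_eq)
      have "continuous_on V (D i)" if "i \<le> m" for i
        by (rule continuous_on_gradient[OF E[OF that]])
      then show "continuous_on ?W (\<lambda>x. \<Sum>i\<le>m. \<xi> i u *\<^sub>R D i x)"
        using W(2) by (intro continuous_on_sum continuous_on_scaleR continuous_on_const) (auto intro: continuous_on_subset)
      show "(\<Sum>i\<le>m. \<xi> i u *\<^sub>R D i x) = pd u ?f x" if "x \<in> ?W" for x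
        using calculation(3)[OF that] \<open>u \<in> Mspace v m\<close> by simp
    qed
    moreover have "u \<in> Mspace v m" if "u \<in> insert \<omega> (v ` {0..p})" for u
      using that Sph_coords(1)[OF \<omega>] p_less_m by (auto simp: Mspace_def intro: span_base)
    ultimately show ?thesis by simp
  qed
qed

section \<open>Reflection, even and odd parts, harmonicity\<close>

lemma reflection_coords:
  assumes "x \<in> \<Omega>"
  shows "proj (proj x - xq x) = proj x" "rad2 (proj x - xq x) = rad2 x" "xq (proj x - xq x) = - xq x"
    "proj x - xq x \<in> \<Omega>"
proof -
  have p0: "proj (xq x) = 0"
    unfolding proj_def xq_def using p_less_m by (subst sum.neutral) (auto simp: \<xi>_sum_v simp del: \<xi>_simps)
  show 1: "proj (proj x - xq x) = proj x"
    using p0 Mspace_p_coords(1)[OF proj_in_Mspace] by simp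
  have \<xi>: "\<xi> s (proj x - xq x) = - \<xi> s x" if "s \<in> {p+1..m}" for s
  proof -
    have "\<xi> s (xq x) = \<xi> s x"
      unfolding xq_def using that by (subst \<xi>_sum_v) auto
    then show ?thesis using Mspace_p_coords(2)[OF proj_in_Mspace that] by simp
  qed
  show 2: "rad2 (proj x - xq x) = rad2 x"
    unfolding rad2_def by (simp add: \<xi> del: \<xi>_simps)
  have "xq (proj x - xq x) = (\<Sum>s\<in>{p+1..m}. - (\<xi> s x *\<^sub>R v s))"
    unfolding xq_def[of "proj x - xq x"] by (simp add: \<xi> del: \<xi>_simps)
  also have "\<dots> = - xq x" by (simp add: sum_negf xq_def)
  finally show "xq (proj x - xq x) = - xq x" .
  have "proj x - xq x \<in> V"
    using V_iff_proj[of "proj x - xq x" x] 1 2 assms by (simp add: \<Omega>_def)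
  moreover have "xq x \<in> Mspace v m"
    unfolding xq_def Mspace_def by (intro span_sum span_scale span_base) auto
  then have "proj x - xq x \<in> Mspace v m"
    using proj_in_Mspace Mspace_mono unfolding Mspace_def by (blast intro: span_diff)
  ultimately show "proj x - xq x \<in> \<Omega>" by (simp add: \<Omega>_def)
qed

text \<open>Every series depends only on \<open>proj\<close> and \<open>rad2\<close>, which the
  reflection preserves, while the prefactor x_q changes sign.\<close>

lemma PE_PO_on_\<Omega>:
  assumes h: "\<And>x. x \<in> \<Omega> \<Longrightarrow> h x = even_lap n x + odd_lap n x" and x: "x \<in> \<Omega>"
  shows "PE v m p h x = even_lap n x" "PO v m p h x = odd_lap n x"
proof -
  let ?y = "proj x - xq x"
  have "x \<in> Mspace v m" using x by (simp add: \<Omega>_def)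
  then have d: "xdiamond v m p x = ?y" by (rule parts_eq)
  have bessel_series: "bessel_series j g ?y = bessel_series j g x" for j g
    unfolding bessel_series_def reflection_coords(1,2)[OF x] ..
  have "even_lap n ?y = even_lap n x" by (simp only: even_lap_def bessel_series)
  moreover have "odd_lap n ?y = - odd_lap n x"
    unfolding odd_lap_def bessel_series reflection_coords(3)[OF x] linear_neg[OF linear_mul(2)] by simp
  ultimately show "PE v m p h x = even_lap n x" "PO v m p h x = odd_lap n x"
    unfolding PE_def PO_def d h[OF x] h[OF reflection_coords(4)[OF x]]
    by (simp_all add: scaleR_2[symmetric])
qed

lemma gps_function_even_lap:
  assumes "\<And>x. x \<in> \<Omega> \<Longrightarrow> f x = even_lap n x"
  shows "gps_function mul v m p \<Omega> f"
  unfolding gps_function_def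
proof (intro exI conjI allI ballI impI)
  \<comment> \<open>The radius enters through r^2 only, which makes this even; the odd component is
    zero.\<close>
  let ?F = "\<lambda>xp r. (\<Prod>l<n. real (m - p) - 1 - 2 * real l) *\<^sub>R
     (\<Sum>k. (bessel_coeff n k * (r\<^sup>2) ^ k) *\<^sub>R (neg_lap v p ^^ k) ((neg_lap v p ^^ n) f0) xp)"
  fix xp r \<omega>
  show "?F xp (- r) = ?F xp r" "(\<lambda>_ _. 0) xp (- r) = - (\<lambda>_ _. 0::'a) xp r" by simp_all
  assume *: "xp \<in> Mspace v p" "\<omega> \<in> Sph v m p" "xp + r *\<^sub>R \<omega> \<in> \<Omega>"
  show "f (xp + r *\<^sub>R \<omega>) = ?F xp r + mul \<omega> ((\<lambda>_ _. 0) xp r)"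
    unfolding assms[OF *(3)] even_lap_def bessel_series_def slice_point(1,2)[OF *(1,2)] by (simp add: mul_simps)
qed

lemma gps_function_odd_lap:
  assumes "\<And>x. x \<in> \<Omega> \<Longrightarrow> f x = odd_lap n x"
  shows "gps_function mul v m p \<Omega> f"
  unfolding gps_function_def
proof (intro exI conjI allI ballI impI)
  \<comment> \<open>The odd factor r comes from x_q = r \<omega>; here the even component is
    zero.\<close>
  let ?F = "\<lambda>xp r. (r * (\<Prod>l<n. real (m - p) - 1 - 2 * real l)) *\<^sub>R
     (\<Sum>k. (bessel_coeff (Suc n) k * (r\<^sup>2) ^ k) *\<^sub>R (neg_lap v p ^^ k) ((neg_lap v p ^^ n) df) xp)"
  fix xp r \<omega>
  show "?F xp (- r) = - ?F xp r" "(\<lambda>_ _. 0) xp (- r) = (\<lambda>_ _. 0::'a) xp r" by simp_all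
  assume *: "xp \<in> Mspace v p" "\<omega> \<in> Sph v m p" "xp + r *\<^sub>R \<omega> \<in> \<Omega>"
  show "f (xp + r *\<^sub>R \<omega>) = (\<lambda>_ _. 0) xp r + mul \<omega> (?F xp r)"
    unfolding assms[OF *(3)] odd_lap_def bessel_series_def slice_point(1-3)[OF *(1,2)] by (simp add: mul_simps)
qed

lemma lap_power_CK:
  "x \<in> \<Omega> \<Longrightarrow> (lap_p v m ^^ n) (CK mul v m p f0) x = even_lap n x + odd_lap n x"
proof (rule lap_power_on_\<Omega>[where h = "\<lambda>i x. even_lap i x + odd_lap i x"])
  fix i
  obtain D D' where "C2 (even_lap i) D (even_lap (Suc i))" "C2 (odd_lap i) D' (odd_lap (Suc i))"
    using C2_even_lap C2_odd_lap by metis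
  from C2_add[OF this] show "\<exists>D. C2 (\<lambda>x. even_lap i x + odd_lap i x) D (\<lambda>x. even_lap (Suc i) x + odd_lap (Suc i) x)"
    by blast
qed (use CK_eq in auto)

lemma harmonic_of_C2:
  assumes "\<exists>D. C2 g D l" "\<And>x. x \<in> \<Omega> \<Longrightarrow> f x = g x" "\<And>x. l x = 0"
  shows "harmonic_on v m \<Omega> f"
  unfolding harmonic_on_def using C2_harmonic_data[of g _ l f] assms by auto

text \<open>With q = 2n + 1 the factor q - 1 - 2l vanishes at l = n, so one Laplacian after the n-th
  annihilates each part separately.\<close>

lemma harmonic_parts:
  assumes "odd (m - p)"
  defines "n \<equiv> (m - p - 1) div 2"
  defines "h \<equiv> (lap_p v m ^^ n) (CK mul v m p f0)"
  shows "harmonic_on v m \<Omega> (PE v m p h)" "gps_function mul v m p \<Omega> (PE v m p h)"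
    "harmonic_on v m \<Omega> (PO v m p h)" "gps_function mul v m p \<Omega> (PO v m p h)"
proof -
  have "m - p = 2 * n + 1" using assms(1) unfolding n_def by presburger
  then have 0: "(\<Prod>l<Suc n. real (m - p) - 1 - 2 * real l) = 0"
    by simp
  have h: "h x = even_lap n x + odd_lap n x" if "x \<in> \<Omega>" for x
    unfolding h_def using that by (rule lap_power_CK)
  note PP = PE_PO_on_\<Omega>[of h n, OF h]
  show "harmonic_on v m \<Omega> (PE v m p h)"
    by (rule harmonic_of_C2[OF C2_even_lap PP(1)]) (auto simp: even_lap_def 0 simp del: prod.lessThan_Suc)
  show "harmonic_on v m \<Omega> (PO v m p h)"
    by (rule harmonic_of_C2[OF C2_odd_lap PP(2)]) (auto simp: odd_lap_def 0 simp del: prod.lessThan_Suc)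
  show "gps_function mul v m p \<Omega> (PE v m p h)"
    by (rule gps_function_even_lap[OF PP(1)])
  show "gps_function mul v m p \<Omega> (PO v m p h)"
    by (rule gps_function_odd_lap[OF PP(2)])
qed

end

section \<open>Instantiation from the algebra and its basis\<close>

text \<open>The left alternative law, polarised at v_s + v_t, reduces the symmetrised product to
  (v_s v_t + v_t v_s) a. For s = t, membership in \<open>SA\<close> gives the conjugate -v_s and
  hence the square -1.\<close>

lemma slice_basis_mul:
  assumes alg: "alt_alg mul e cj" and sb: "slice_basis mul e cj v m" and s: "s \<in> {1..m}" and t: "t \<in> {1..m}"
  shows "mul (v s) (mul (v t) a) + mul (v t) (mul (v s) a) = (if s = t then - (2 *\<^sub>R a) else 0)"
proof -
  have bil: "bilinear mul" and left: "mul (mul x x) y = mul x (mul x y)" and unit: "mul e x = x" for x y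
    using alg by (auto simp: alt_alg_def assoc_def)
  note lin = bilinear_ladd[OF bil] bilinear_radd[OF bil] bilinear_lneg[OF bil] bilinear_rneg[OF bil]
  have "mul (mul (v s + v t) (v s + v t)) a = mul (v s + v t) (mul (v s + v t) a)" by (rule left)
  then have *: "mul (v s) (mul (v t) a) + mul (v t) (mul (v s) a) = mul (mul (v s) (v t)) a + mul (mul (v t) (v s)) a"
    by (simp add: lin left algebra_simps)
  show ?thesis
  proof (cases "s = t")
    case True
    have "v s + cj (v s) = 0" and n: "mul (v s) (cj (v s)) = e"
      using sb s by (auto simp: slice_basis_def SA_def trc_def nrm_def)
    then have "cj (v s) = - v s" by (simp add: add_eq_0_iff)
    then have "- mul (v s) (v s) = e" using n by (simp add: lin)
    then have "mul (v s) (v s) = - e" by (metis minus_minus)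
    then have "mul (v s) (mul (v s) a) = - a"
      unfolding left[symmetric] by (simp add: lin unit)
    then have "mul (v s) (mul (v s) a) + mul (v s) (mul (v s) a) = - (2 *\<^sub>R a)"
      by (simp only: scaleR_2) simp
    then show ?thesis using True by (simp only: simp_thms if_True)
  next
    case False
    then have "mul (v s) (v t) = - mul (v t) (v s)" using sb s t unfolding slice_basis_def by blast
    then have "mul (mul (v s) (v t)) a + mul (mul (v t) (v s)) a = 0"
      by (simp only: lin) simp
    then show ?thesis using False * by (simp only: if_False)
  qed
qed

text \<open>The dual basis is prescribed on the independent vectors and extended linearly to the
  whole space; injectivity translates equality of vectors into equality of indices.\<close>

lemma dual_functionals:
  assumes "inj_on v {0..m::nat}" "independent (v ` {0..m})"
  obtains \<xi> :: "nat \<Rightarrow> 'a::real_vector \<Rightarrow> real"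
  where "\<And>s. linear (\<xi> s)" "\<And>s t. s \<le> m \<Longrightarrow> t \<le> m \<Longrightarrow> \<xi> s (v t) = (if s = t then 1 else 0)"
proof -
  have "\<forall>s. \<exists>g. linear g \<and> (\<forall>x\<in>v ` {0..m}. g x = (if x = v s then 1 else (0::real)))"
  proof
    fix s
    show "\<exists>g. linear g \<and> (\<forall>x\<in>v ` {0..m}. g x = (if x = v s then 1 else (0::real)))"
      using linear_independent_extend[OF assms(2), of "\<lambda>x. if x = v s then 1 else 0"] .
  qed
  from choice[OF this] obtain \<xi> :: "nat \<Rightarrow> 'a \<Rightarrow> real"
    where "\<forall>s. linear (\<xi> s) \<and> (\<forall>x\<in>v ` {0..m}. \<xi> s x = (if x = v s then 1 else 0))" ..
  then have \<xi>: "\<And>s. linear (\<xi> s)" "\<And>s x. x \<in> v ` {0..m} \<Longrightarrow> \<xi> s x = (if x = v s then 1 else 0)"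
    by blast+
  show ?thesis
  proof (rule that[of \<xi>])
    show "\<xi> s (v t) = (if s = t then 1 else 0)" if "s \<le> m" "t \<le> m" for s t
      using that assms(1) by (auto simp: \<xi>(2) inj_on_eq_iff)
  qed (rule \<xi>(1))
qed

theorem theorem5p2:
  fixes mul :: "'a::euclidean_space \<Rightarrow> 'a \<Rightarrow> 'a" and e :: 'a and cj :: "'a \<Rightarrow> 'a"
    and v :: "nat \<Rightarrow> 'a" and m p q :: nat and \<Omega>0 :: "'a set" and f0 :: "'a \<Rightarrow> 'a"
  assumes "alt_alg mul e cj"
    and "slice_basis mul e cj v m"
    and "p < m" and "q = m - p" and "odd q"
    and "openin (top_of_set (Mspace v p)) \<Omega>0" and "connected \<Omega>0" and "\<Omega>0 \<noteq> {}"
    and "real_analytic_on v p \<Omega>0 f0"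
  shows "\<exists>\<Omega>. \<Omega>0 \<subseteq> \<Omega> \<and>
           openin (top_of_set (Mspace v m)) \<Omega> \<and> connected \<Omega> \<and>
           p_symmetric v m p \<Omega> \<and> slice_domain v m p \<Omega> \<and>
           (\<forall>x\<in>\<Omega>. xpart v m p x \<in> \<Omega>0 \<and>
              summable (CK_even v m p f0 x) \<and> summable (CK_odd mul v m p f0 x)) \<and>
           gps_monogenic mul v m p \<Omega> (CK mul v m p f0) \<and>
           harmonic_on v m \<Omega> (PE v m p ((lap_p v m ^^ ((q - 1) div 2)) (CK mul v m p f0))) \<and>
           gps_function mul v m p \<Omega> (PE v m p ((lap_p v m ^^ ((q - 1) div 2)) (CK mul v m p f0))) \<and>
           harmonic_on v m \<Omega> (PO v m p ((lap_p v m ^^ ((q - 1) div 2)) (CK mul v m p f0))) \<and>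
           gps_function mul v m p \<Omega> (PO v m p ((lap_p v m ^^ ((q - 1) div 2)) (CK mul v m p f0)))"
proof -
  have "inj_on v {0..m}" "independent (v ` {0..m})" and v0: "v 0 = e"
    using assms(2) by (auto simp: slice_basis_def)
  then obtain \<xi> :: "nat \<Rightarrow> 'a \<Rightarrow> real"
    where \<xi>: "\<And>s. linear (\<xi> s)" "\<And>s t. s \<le> m \<Longrightarrow> t \<le> m \<Longrightarrow> \<xi> s (v t) = (if s = t then 1 else 0)"
    using dual_functionals by blast
  interpret coordinate_frame v m p \<xi>
    by (rule coordinate_frame.intro[OF assms(3) \<xi>])
  have sub: "\<Omega>0 \<subseteq> Mspace v p"
    using openin_imp_subset[OF assms(6)] .
  \<comment> \<open>Radius and rate are chosen as functions of the centre, as the locale requires;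
    the family stays existentially quantified, as in \<open>regular\<close>.\<close>
  have "\<exists>\<sigma> L. \<sigma> > 0 \<and> L > 0 \<and> (\<forall>x\<in>cylinder a \<sigma>. proj x \<in> \<Omega>0) \<and>
      (\<exists>F. family (cylinder a \<sigma>) L F \<and> (\<forall>x\<in>cylinder a \<sigma>. F {#} x = f0 (proj x)))" if "a \<in> \<Omega>0" for a
  proof -
    have "a \<in> Mspace v p" using that sub by blast
    from analytic_family[OF assms(9) that this] show ?thesis by metis
  qed
  then obtain \<sigma> L where \<sigma>L: "\<And>a. a \<in> \<Omega>0 \<Longrightarrow> \<sigma> a > 0" "\<And>a. a \<in> \<Omega>0 \<Longrightarrow> L a > 0"
      "\<And>a x. a \<in> \<Omega>0 \<Longrightarrow> x \<in> cylinder a (\<sigma> a) \<Longrightarrow> proj x \<in> \<Omega>0"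
      "\<And>a. a \<in> \<Omega>0 \<Longrightarrow> \<exists>F. family (cylinder a (\<sigma> a)) (L a) F \<and> (\<forall>x\<in>cylinder a (\<sigma> a). F {#} x = f0 (proj x))"
    by metis
  interpret analytic_neighbourhoods v m p \<xi> \<Omega>0 \<sigma> L
    using \<sigma>L(1-3) sub by unfold_locales auto
  interpret slice_algebra v m p \<xi> \<Omega>0 \<sigma> L mul f0
  proof unfold_locales
    show "bilinear mul" "\<And>a. mul (v 0) a = a"
      using assms(1) v0 by (auto simp: alt_alg_def)
    show "regular f0"
      using \<sigma>L(4) by (simp add: regular_def represents_def)
  qed (rule slice_basis_mul[OF assms(1,2)])
  have "\<forall>x\<in>\<Omega>. xpart v m p x \<in> \<Omega>0 \<and>
      summable (CK_even v m p f0 x) \<and> summable (CK_odd mul v m p f0 x)"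
    using CK_summable parts_eq(1) proj_in_\<Omega>0 by (auto simp: \<Omega>_def)
  then show ?thesis
    using \<Omega>0_sub_\<Omega> \<Omega>_topology[OF assms(7,8)] CK_monogenic harmonic_parts assms(4,5)
    by (intro exI[of _ \<Omega>]) simp
qed

end
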